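(* Let $p=2$. For every $\mathbf r=(r_1,r_2)\in\mathbb Z^2$, \[ {\rm coeff}_{\left[\zeta_1^{r_1},\,\zeta_{2}^{r_2}\right]} F\left(\zeta_1,\zeta_2;q\right)=q^{2Q(\mathbf r)} \frac{\eta(\tau)^5}{\eta(2\tau)}\, {\rm coeff}_{\left[\zeta_1^{2r_1-r_2},\,\zeta_{2}^{r_1+r_2}\right]} f\left(\mathbf{z};\tau\right), \] where on the right the coefficient is taken in the Laurent expansion of $f$ in the region $|q|<|\zeta_j|<1$ ($j\in\{1,2\}$), $|q|<|\zeta_1\zeta_2|<1$.
   Context: $q:=e^{2\pi i\tau}$ with $\tau\in\mathbb H$, $\zeta_j:=e^{2\pi i z_j}$, $\mathbf z=(z_1,z_2)$. $Q(\mathbf n):=n_1^2+n_2^2-n_1n_2$. For an integer $p\ge2$, \begin{align*} F(\zeta_1,\zeta_2;q)&:=\sum_{n_1,n_2\in\mathbb Z}\frac{q^{p\left(\left(n_1-\frac{1}{p}\right)^2+\left(n_2-\frac{1}{p}\right)^2-\left(n_1-\frac{1}{p}\right)\left(n_2-\frac{1}{p}\right)\right)}}{\left(1-\zeta_1^{-1}\right)\left(1-\zeta_2^{-1}\right)\left(1-\zeta_1^{-1}\zeta_2^{-1}\right)}\Big(\zeta_1^{n_1-1} \zeta_2^{n_2-1} -\zeta_1^{-n_1+n_2-1}\zeta_2^{n_2-1}\\ &\qquad-\zeta_1^{n_1-1}\zeta_2^{-n_2+n_1-1}+\zeta_1^{-n_2-1} \zeta_2^{-n_2+n_1-1}+\zeta_1^{-n_1+n_2-1}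 \zeta_2^{-n_1-1}-\zeta_1^{-n_2-1}\zeta_2^{-n_1-1}\Big); \end{align*} each rational function of $\zeta_1,\zeta_2$ appearing as a summand is a Laurent polynomial, so $F$ is a $q$-series (in rational powers of $q$) with Laurent polynomial coefficients, and ${\rm coeff}_{[\zeta_1^{r_1},\zeta_2^{r_2}]}$ denotes the coefficient of $\zeta_1^{r_1}\zeta_2^{r_2}$. $\vartheta(z;\tau):=\sum_{n\in\frac12+\mathbb Z}q^{\frac{n^2}{2}}e^{2\pi in(z+\frac12)}$, $\eta(\tau):=q^{\frac1{24}}\prod_{n\ge1}(1-q^n)$, and $f(\mathbf z;\tau):=\frac{\vartheta(z_1;2\tau)\vartheta(z_2;2\tau)\vartheta(z_1+z_2;2\tau)}{\vartheta(z_1;\tau)\vartheta(z_2;\tau)\vartheta(z_1+z_2;\tau)}$. *)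

theory Defs
  imports "HOL-Analysis.Analysis"
begin

definition qpow :: "complex \<Rightarrow> real \<Rightarrow> complex" where
  "qpow \<tau> x = exp (2 * complex_of_real pi * \<i> * \<tau> * complex_of_real x)"

definition nome :: "complex \<Rightarrow> complex" where
  "nome \<tau> = exp (2 * complex_of_real pi * \<i> * \<tau>)"

definition Qf :: "real \<Rightarrow> real \<Rightarrow> real" where
  "Qf x y = x^2 + y^2 - x * y"

definition eta :: "complex \<Rightarrow> complex" where
  "eta \<tau> = qpow \<tau> (1/24) * (\<Prod>n. (1 - nome \<tau> ^ Suc n))"

definition vartheta :: "complex \<Rightarrow> complex \<Rightarrow> complex" where
  "vartheta z \<tau> = (\<Sum>\<^sub>\<infinity>k::int.
      (let n = real_of_int k + 1/2 in
        qpow \<tau> (n^2 / 2) * exp (2 * complex_of_real pi * \<i> * complex_of_real n * (z + 1/2))))"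

definition ffun :: "complex \<Rightarrow> complex \<Rightarrow> complex \<Rightarrow> complex" where
  "ffun z1 z2 \<tau> =
     (vartheta z1 (2*\<tau>) * vartheta z2 (2*\<tau>) * vartheta (z1 + z2) (2*\<tau>)) /
     (vartheta z1 \<tau> * vartheta z2 \<tau> * vartheta (z1 + z2) \<tau>)"

definition Fsummand :: "int \<Rightarrow> int \<Rightarrow> complex \<Rightarrow> complex \<Rightarrow> complex" where
  "Fsummand n1 n2 a b =
     (a powi (n1 - 1) * b powi (n2 - 1)
      - a powi (-n1 + n2 - 1) * b powi (n2 - 1)
      - a powi (n1 - 1) * b powi (-n2 + n1 - 1)
      + a powi (-n2 - 1) * b powi (-n2 + n1 - 1)
      + a powi (-n1 + n2 - 1) * b powi (-n1 - 1)
      - a powi (-n2 - 1) * b powi (-n1 - 1))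
     / ((1 - inverse a) * (1 - inverse b) * (1 - inverse a * inverse b))"

text \<open>Coefficient of zeta1^r1 zeta2^r2 of a rational function g of (zeta1,zeta2) that is a
  Laurent polynomial: the unique finitely supported coefficient family c whose Laurent
  polynomial agrees with g wherever g's defining expression is defined.\<close>
definition lpoly_coeff :: "(complex \<Rightarrow> complex \<Rightarrow> complex) \<Rightarrow> int \<times> int \<Rightarrow> complex" where
  "lpoly_coeff g = (THE c. finite {m. c m \<noteq> 0} \<and>
     (\<forall>a b. a \<noteq> 0 \<and> b \<noteq> 0 \<and> a \<noteq> 1 \<and> b \<noteq> 1 \<and> a * b \<noteq> 1 \<longrightarrow>
        g a b = (\<Sum>m\<in>{m. c m \<noteq> 0}. c m * a powi fst m * b powi snd m)))"

definition F_coeff_term :: "nat \<Rightarrow> complex \<Rightarrow> int \<times> int \<Rightarrow> int \<times> int \<Rightarrow> complex" where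
  "F_coeff_term p \<tau> r n =
     qpow \<tau> (real p * Qf (real_of_int (fst n) - 1 / real p) (real_of_int (snd n) - 1 / real p))
     * lpoly_coeff (Fsummand (fst n) (snd n)) r"

definition region :: "complex \<Rightarrow> complex \<Rightarrow> complex \<Rightarrow> bool" where
  "region \<tau> z1 z2 \<longleftrightarrow>
     (let a = exp (2 * complex_of_real pi * \<i> * z1); b = exp (2 * complex_of_real pi * \<i> * z2) in
       norm (nome \<tau>) < norm a \<and> norm a < 1 \<and>
       norm (nome \<tau>) < norm b \<and> norm b < 1 \<and>
       norm (nome \<tau>) < norm (a * b) \<and> norm (a * b) < 1)"

definition region_laurent_coeff :: "(complex \<Rightarrow> complex \<Rightarrow> complex) \<Rightarrow> complex \<Rightarrow> int \<times> int \<Rightarrow> complex" where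
  "region_laurent_coeff g \<tau> = (THE c. \<forall>z1 z2. region \<tau> z1 z2 \<longrightarrow>
     ((\<lambda>m. c m * exp (2 * complex_of_real pi * \<i> * z1) powi fst m
                 * exp (2 * complex_of_real pi * \<i> * z2) powi snd m) has_sum g z1 z2) UNIV)"

end

theory Submission
  imports Defs
begin

text \<open>
  Put \<open>q = nome \<tau>\<close> and let \<open>\<theta>\<^sub>p\<close> be the theta series of nome \<open>p\<close>. Multiplying Laurent series shows
  that \<open>1/\<theta>\<^sub>p\<close> has partial theta functions as coefficients, and that an Appell type series \<open>B(a,b)\<close> of
  nome \<open>q\<^sup>2\<close> equals, up to a constant, \<open>\<theta>(a) / (\<theta>(qb) \<theta>(qab))\<close>. Since the triple product gives
  \<open>\<theta>\<^sub>q(a) \<sim> \<theta>(a) \<theta>(qa)\<close> with nome \<open>q\<^sup>2\<close> on the right, \<open>B(a,b) / \<theta>\<^sub>q(a)\<close> is the product of the three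
  \<open>1/\<theta>(q\<zeta>)\<close>, which is \<open>f\<close> up to eta factors. So the Laurent coefficients of \<open>f\<close> are explicit double
  sums of false theta type. On the other side, each summand of \<open>F\<close> is a Weyl character of \<open>sl\<^sub>3\<close>, whose
  coefficients are alternating sums of a piecewise linear function; shifting the summation lattice
  telescopes that function to indicator functions of cones, and the resulting cone sums are the
  same double sums.
\<close>

section \<open>Unconditional summation\<close>

text \<open>Multiplying the three expansions of 1/theta directly would give a fourfold sum for each
  coefficient, while F offers a lattice of rank two. The series B is what closes this gap. As a
  function of b, the quotient theta(a) / (theta(q b) theta(q a b)) has simple poles at b = q^(-2n-1)
  and at a b = q^(-2n-1). Up to a constant its partial fractions are the sum over n of q^(2n(n+1))
  (a^(-n) / (1 - b q^(2n+1)) - a^(n+1) / (1 - a b q^(2n+1))), and B is the geometric expansion of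
  these fractions on the annulus. Two reciprocal thetas thus cost one summation, and dividing by the
  theta of nome q costs the second. No pole argument enters the proof. Each product is multiplied
  out, a shift of indices separates the variables, and unwanted terms vanish because theta(1) = 0.
  The one place where this fails is the constant term of theta times 1/theta, where the separated
  series diverges; there Jacobi's identity for the cube of the Euler product supplies the
  value.\<close>

lemma summable_on_norm_times:
  fixes f :: "'a \<Rightarrow> 'c :: {real_normed_field, banach}" and g :: "'b \<Rightarrow> 'c"
  assumes "(\<lambda>x. norm (f x)) summable_on A" "(\<lambda>x. norm (g x)) summable_on B"
  shows "(\<lambda>(x,y). norm (f x * g y)) summable_on A \<times> B"
proof (rule summable_on_SigmaI)
  show "((\<lambda>y. case (x, y) of (x, y) \<Rightarrow> norm (f x * g y)) has_sum
          (norm (f x) * infsum (\<lambda>y. norm (g y)) B)) B" for x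
    unfolding norm_mult prod.case by (rule has_sum_cmult_right) (use assms in auto)
  show "(\<lambda>x. norm (f x) * infsum (\<lambda>y. norm (g y)) B) summable_on A"
    by (rule summable_on_cmult_left) (use assms in auto)
qed auto

lemma has_sum_times:
  fixes f :: "'a \<Rightarrow> complex" and g :: "'b \<Rightarrow> complex"
  assumes "(f has_sum S) A" "(g has_sum T) B"
  shows "((\<lambda>(x,y). f x * g y) has_sum (S * T)) (A \<times> B)"
proof (rule has_sum_SigmaI)
  show "((\<lambda>y. case (x, y) of (x, y) \<Rightarrow> f x * g y) has_sum (f x * T)) B" for x
    using has_sum_cmult_right[OF assms(2), of "f x"] by simp
  show "((\<lambda>x. f x * T) has_sum (S * T)) A"
    by (rule has_sum_cmult_left[OF assms(1)])
  have "(\<lambda>x. norm (f x)) summable_on A" "(\<lambda>x. norm (g x)) summable_on B"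
    using assms[THEN has_sum_imp_summable] by (auto simp: summable_on_iff_abs_summable_on_complex)
  from summable_on_norm_times[OF this] show "(\<lambda>(x,y). f x * g y) summable_on A \<times> B"
    by (subst summable_on_iff_abs_summable_on_complex) (simp add: case_prod_unfold)
qed

lemma has_sum_diff:
  fixes f g :: "'a \<Rightarrow> complex"
  assumes "(f has_sum a) A" "(g has_sum b) A"
  shows "((\<lambda>x. f x - g x) has_sum (a - b)) A"
  using has_sum_add[OF assms(1) has_sum_uminusI[OF assms(2)]] by simp

lemma summable_on_diff:
  fixes f g :: "'a \<Rightarrow> complex"
  assumes "f summable_on A" "g summable_on A"
  shows "(\<lambda>x. f x - g x) summable_on A"
  using assms has_sum_diff unfolding summable_on_def by blast

lemma summable_on_norm_bound:
  fixes f :: "'a \<Rightarrow> complex"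
  assumes "g summable_on A" "\<And>x. x \<in> A \<Longrightarrow> norm (f x) \<le> g x"
  shows "f summable_on A"
  using Infinite_Sum.abs_summable_on_comparison_test'[OF assms] summable_on_iff_abs_summable_on_complex by blast

lemma summable_on_int_nat_abs_bound:
  fixes f :: "int \<Rightarrow> real"
  assumes "summable g" "\<And>k. 0 \<le> f k" "\<And>k. f k \<le> g (nat \<bar>k\<bar>)"
  shows "f summable_on UNIV"
proof -
  have g: "g summable_on UNIV"
  proof (rule summable_nonneg_imp_summable_on)
    show "0 \<le> g n" for n using assms(2)[of "int n"] assms(3)[of "int n"] by simp
  qed (fact assms)
  have "(\<lambda>k. g (nat \<bar>k\<bar>)) summable_on (range int \<union> range (\<lambda>n. - int n))"
  proof (rule summable_on_union)
    show "(\<lambda>k. g (nat \<bar>k\<bar>)) summable_on range int"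
      by (subst summable_on_reindex) (use g in \<open>auto simp: inj_on_def o_def\<close>)
    show "(\<lambda>k. g (nat \<bar>k\<bar>)) summable_on range (\<lambda>n. - int n)"
      by (subst summable_on_reindex) (use g in \<open>auto simp: inj_on_def o_def\<close>)
  qed
  moreover have "range int \<union> range (\<lambda>n. - int n) = UNIV"
    by (auto intro: int_cases2)
  ultimately show ?thesis
    using assms by (auto intro: summable_on_comparison_test)
qed

lemma power_int_le_nat_abs_power:
  fixes c d :: real
  assumes "0 < c" "c \<le> d" "inverse c \<le> d"
  shows "c powi k \<le> d ^ nat \<bar>k\<bar>"
proof (cases "k \<ge> 0")
  case True
  then show ?thesis using assms by (simp add: power_int_def power_mono)
next
  case False
  then show ?thesis using assms by (simp add: power_int_def power_mono flip: inverse_eq_divide power_inverse)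
qed

lemma summable_gauss:
  fixes t c :: real
  assumes "0 \<le> t" "t < 1" "0 \<le> c"
  shows "summable (\<lambda>n. t ^ (n * n) * c ^ n)"
proof -
  have "(\<lambda>n. t ^ n * c) \<longlonglongrightarrow> 0 * c"
    using assms by (intro tendsto_mult LIMSEQ_power_zero tendsto_const) auto
  then have "eventually (\<lambda>n. t ^ n * c < 1/2) sequentially"
    by (rule order_tendstoD) simp
  then have "eventually (\<lambda>n. norm (t ^ (n * n) * c ^ n) \<le> (1/2) ^ n) sequentially"
  proof eventually_elim
    case (elim n)
    have "norm (t ^ (n * n) * c ^ n) = (t ^ n * c) ^ n"
      using assms by (simp add: power_mult power_mult_distrib)
    also have "\<dots> \<le> (1/2) ^ n"
      using elim assms by (intro power_mono) auto
    finally show ?case .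
  qed
  then show ?thesis
    by (rule summable_comparison_test_ev) (simp add: summable_geometric)
qed

lemma summable_on_gauss_abs:
  fixes t c :: real
  assumes "0 < t" "t < 1" "0 \<le> c"
  shows "(\<lambda>k::int. t powi (k * k) * c ^ nat \<bar>k\<bar>) summable_on UNIV"
proof (rule summable_on_int_nat_abs_bound[OF summable_gauss[of t c]])
  fix k :: int
  show "t powi (k * k) * c ^ nat \<bar>k\<bar> \<le> t ^ (nat \<bar>k\<bar> * nat \<bar>k\<bar>) * c ^ nat \<bar>k\<bar>"
    by (simp add: power_int_def flip: nat_mult_distrib)
qed (use assms in auto)

lemma summable_on_gauss:
  fixes s x :: complex
  assumes "s \<noteq> 0" "norm s < 1" "x \<noteq> 0"
  shows "(\<lambda>k::int. s powi (k * k) * x powi k) summable_on UNIV"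
proof (rule summable_on_norm_bound[OF summable_on_gauss_abs[of "norm s" "norm x + inverse (norm x)"]])
  fix k :: int
  show "norm (s powi (k * k) * x powi k) \<le> norm s powi (k * k) * (norm x + inverse (norm x)) ^ nat \<bar>k\<bar>"
    unfolding norm_mult norm_power_int using assms
    by (intro mult_left_mono power_int_le_nat_abs_power) auto
qed (use assms in auto)

lemma summable_on_two_sided_geometric:
  fixes t :: real and x :: complex
  assumes "0 < t" "t < norm x" "norm x < 1 / t"
  shows "(\<lambda>k::int. t ^ nat \<bar>k\<bar> * norm x powi k) summable_on UNIV"
proof -
  define d where "d = max (t * norm x) (t / norm x)"
  have x: "norm x > 0" using assms by linarith
  have d: "0 \<le> d" "d < 1"
    using assms x by (auto simp: d_def field_simps le_max_iff_disj)
  show ?thesis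
  proof (rule summable_on_int_nat_abs_bound[of "\<lambda>n. d ^ n"])
    fix k :: int
    show "t ^ nat \<bar>k\<bar> * norm x powi k \<le> d ^ nat \<bar>k\<bar>"
    proof (cases "k \<ge> 0")
      case True
      then have "t ^ nat \<bar>k\<bar> * norm x powi k = (t * norm x) ^ nat \<bar>k\<bar>"
        by (simp add: power_int_def power_mult_distrib)
      also have "\<dots> \<le> d ^ nat \<bar>k\<bar>"
        using assms x by (intro power_mono) (auto simp: d_def)
      finally show ?thesis .
    next
      case False
      then have "t ^ nat \<bar>k\<bar> * norm x powi k = (t / norm x) ^ nat \<bar>k\<bar>"
        by (simp add: power_int_def power_divide field_simps)
      also have "\<dots> \<le> d ^ nat \<bar>k\<bar>"
        using assms x by (intro power_mono) (auto simp: d_def)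
      finally show ?thesis .
    qed
  qed (use assms d in \<open>auto simp: summable_geometric\<close>)
qed

lemma infsum_antisymmetric:
  fixes g :: "int \<Rightarrow> complex"
  assumes "g summable_on UNIV" "\<And>n. g (c - n) = - g n"
  shows "infsum g UNIV = 0"
proof -
  have "infsum g UNIV = infsum (\<lambda>n. g (c - n)) UNIV"
    by (rule infsum_reindex_bij_witness[of _ "\<lambda>n. c - n" "\<lambda>n. c - n"]) auto
  also have "\<dots> = - infsum g UNIV"
    by (simp add: assms infsum_uminus)
  finally show ?thesis by simp
qed

text \<open>The reflection need not exchange the two half-lines, since \<open>c\<close> is
  arbitrary; only the vanishing of the bilateral sum is used. The false theta series below owe to
  this their two interchangeable representations.\<close>

lemma infsum_antisymmetric_half:
  fixes g :: "int \<Rightarrow> complex"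
  assumes "g summable_on UNIV" "\<And>n. g (c - n) = - g n"
  shows "infsum g {0..} = - infsum g {..<0}"
proof -
  have "infsum g UNIV = infsum g ({0..} \<union> {..<0})"
    by (rule arg_cong[of _ _ "infsum g"]) auto
  also have "\<dots> = infsum g {0..} + infsum g {..<0}"
    by (rule infsum_Un_disjoint) (use assms in \<open>auto intro: summable_on_subset\<close>)
  finally show ?thesis
    using infsum_antisymmetric[OF assms] by (simp add: eq_neg_iff_add_eq_0)
qed

text \<open>Tannery's theorem, obtained from Lebesgue's theorem for the counting measure, whose
  integral agrees with \<open>infsum\<close> on absolutely summable families. It carries the finite
  triple product to its limit.\<close>

lemma infsum_dominated_convergence:
  fixes f :: "nat \<Rightarrow> 'a \<Rightarrow> complex"
  assumes lim: "\<And>k. (\<lambda>n. f n k) \<longlonglongrightarrow> g k"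
    and M: "M summable_on UNIV" and bound: "\<And>n k. norm (f n k) \<le> M k"
  shows "(\<lambda>n. infsum (f n) UNIV) \<longlonglongrightarrow> infsum g UNIV"
proof -
  have gM: "norm (g k) \<le> M k" for k
    using tendsto_norm[OF lim] bound by (rule Lim_bounded[where M = 0, rule_format]) 
  have M': "Infinite_Set_Sum.abs_summable_on M UNIV"
    using M summable_on_iff_abs_summable_on_real abs_summable_equivalent by blast
  have sf: "Infinite_Set_Sum.abs_summable_on (f n) UNIV" for n
    by (rule Infinite_Set_Sum.abs_summable_on_comparison_test'[OF M' bound])
  have sg: "Infinite_Set_Sum.abs_summable_on g UNIV"
    by (rule Infinite_Set_Sum.abs_summable_on_comparison_test'[OF M' gM])
  have "(\<lambda>n. integral\<^sup>L (count_space UNIV) (f n)) \<longlonglongrightarrow> integral\<^sup>L (count_space UNIV) g"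
    by (rule integral_dominated_convergence[where w = M])
       (use M' lim bound in \<open>auto simp: Infinite_Set_Sum.abs_summable_on_def\<close>)
  then show ?thesis
    by (simp add: infsetsum_infsum[OF sf, symmetric] infsetsum_infsum[OF sg, symmetric] infsetsum_def)
qed

section \<open>The triple product\<close>

definition qpoch :: "complex \<Rightarrow> nat \<Rightarrow> complex" where
  "qpoch p n = (\<Prod>i<n. 1 - p ^ Suc i)"

definition euler :: "complex \<Rightarrow> complex" where
  "euler p = (\<Prod>n. 1 - p ^ Suc n)"

text \<open>The parameter \<open>s\<close> is a square root of the nome: with \<open>p = s\<^sup>2\<close> the weight
  \<open>s\<^bsup>k(k-1)\<^esup>\<close> is \<open>p\<^bsup>k(k-1)/2\<^esup>\<close>, and halves never occur in exponents.\<close>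
definition theta :: "complex \<Rightarrow> complex \<Rightarrow> complex" where
  "theta s x = (\<Sum>\<^sub>\<infinity>k::int. (-1) powi k * s powi (k * (k - 1)) * x powi k)"

lemma qpoch_0 [simp]: "qpoch p 0 = 1"
  by (simp add: qpoch_def)

lemma qpoch_Suc: "qpoch p (Suc n) = qpoch p n * (1 - p ^ Suc n)"
  by (simp add: qpoch_def)

lemma one_minus_power_nonzero:
  fixes p :: complex assumes "norm p < 1" shows "1 - p ^ Suc n \<noteq> 0"
proof
  assume "1 - p ^ Suc n = 0"
  then have "norm (p ^ Suc n) = 1" by (metis norm_one right_minus_eq)
  moreover have "norm (p ^ Suc n) < 1"
    using assms by (simp add: norm_power power_less_one_iff del: power_Suc)
  ultimately show False by simp
qed

lemma qpoch_nonzero: "norm p < 1 \<Longrightarrow> qpoch p n \<noteq> 0"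
  using one_minus_power_nonzero[of p] by (auto simp: qpoch_def)

lemma convergent_prod_euler:
  assumes "norm p < 1" shows "convergent_prod (\<lambda>n. 1 - p ^ Suc n :: complex)"
proof -
  have "summable (\<lambda>i. norm p * norm p ^ i)"
    using assms by (intro summable_mult summable_geometric) auto
  then have "summable (\<lambda>i. norm (1 - p ^ Suc i - 1))"
    by (simp add: norm_mult norm_power)
  then show ?thesis
    by (intro abs_convergent_prod_imp_convergent_prod summable_imp_abs_convergent_prod)
qed

lemma euler_nonzero: "norm p < 1 \<Longrightarrow> euler p \<noteq> 0"
  unfolding euler_def
  by (rule prodinf_nonzero[OF convergent_prod_euler one_minus_power_nonzero])

lemma qpoch_tendsto_euler:
  assumes "norm p < 1" shows "qpoch p \<longlonglongrightarrow> euler p"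
proof -
  have "(\<lambda>n. \<Prod>i\<le>n. 1 - p ^ Suc i) \<longlonglongrightarrow> euler p"
    unfolding euler_def by (rule convergent_prod_LIMSEQ[OF convergent_prod_euler[OF assms]])
  then have "(\<lambda>n. qpoch p (Suc n)) \<longlonglongrightarrow> euler p"
    by (simp add: qpoch_def lessThan_Suc_atMost)
  then show ?thesis by (simp add: filterlim_sequentially_Suc)
qed

lemma qpoch_bounded:
  assumes "norm p < 1"
  obtains K where "K > 0" "\<And>n. norm (qpoch p n) \<le> K" "\<And>n. norm (inverse (qpoch p n)) \<le> K"
proof -
  have "Bseq (qpoch p)"
    by (rule convergent_imp_Bseq) (use qpoch_tendsto_euler[OF assms] in \<open>auto simp: convergent_def\<close>)
  moreover have "Bseq (\<lambda>n. inverse (qpoch p n))"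
    by (rule convergent_imp_Bseq)
       (use tendsto_inverse[OF qpoch_tendsto_euler[OF assms] euler_nonzero[OF assms]] in \<open>auto simp: convergent_def\<close>)
  ultimately obtain K L where "\<And>n. norm (qpoch p n) \<le> K" "\<And>n. norm (inverse (qpoch p n)) \<le> L" "K > 0"
    by (auto simp: Bseq_def)
  then show ?thesis by (intro that[of "max K L"]) (auto simp: le_max_iff_disj)
qed

section \<open>Gauss's q-binomial theorem\<close>

definition qbinom :: "complex \<Rightarrow> nat \<Rightarrow> nat \<Rightarrow> complex" where
  "qbinom p m k = (if k \<le> m then qpoch p m / (qpoch p k * qpoch p (m - k)) else 0)"

lemma qbinom_Suc_Suc:
  assumes "norm p < 1" "k \<le> m"
  shows "qbinom p (Suc m) (Suc k) = qbinom p m (Suc k) + p ^ (m - k) * qbinom p m k"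
proof (cases "k = m")
  case True
  then show ?thesis using qpoch_nonzero[OF assms(1)] by (simp add: qbinom_def)
next
  case False
  then obtain d where d: "m = Suc (k + d)"
    using assms(2) by (metis add_Suc_right le_neq_implies_less less_imp_Suc_add)
  define u v where "u = p ^ Suc k" and "v = p ^ Suc d"
  have uv: "p ^ Suc m = u * v" "p ^ (m - k) = v"
    by (simp_all add: u_def v_def d power_add mult_ac)
  have *: "qpoch p (Suc m) = qpoch p m * (1 - u * v)" "qpoch p (Suc k) = qpoch p k * (1 - u)"
      "qpoch p (Suc d) = qpoch p d * (1 - v)"
    by (simp_all only: qpoch_Suc uv u_def v_def)
  have [simp]: "u \<noteq> 1" "v \<noteq> 1"
    using one_minus_power_nonzero[OF assms(1), of k] one_minus_power_nonzero[OF assms(1), of d]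
    by (auto simp: u_def v_def)
  have i: "Suc m - Suc k = Suc d" "m - Suc k = d" "m - k = Suc d" "Suc k \<le> m" "k \<le> m"
    using d by auto
  have "P * (1 - u * v) / ((K * U) * (D * V)) = P / ((K * U) * D) + v * (P / (K * (D * V)))"
    if "K \<noteq> 0" "D \<noteq> 0" "U \<noteq> 0" "V \<noteq> 0" "U = 1 - u" "V = 1 - v" for P K D U V
  proof -
    have "P * (1 - u * v) = P * V + v * P * U" unfolding that(5,6) by (simp add: algebra_simps)
    then show ?thesis using that(1-4) by (simp add: field_simps)
  qed
  from this[of "qpoch p k" "qpoch p d" "1 - u" "1 - v" "qpoch p m"] show ?thesis
    unfolding qbinom_def uv using i qpoch_nonzero[OF assms(1)]
    by (simp add: *)
qed

lemma gauss_binomial: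
  assumes "norm s < 1"
  shows "(\<Prod>i<m. 1 + y * (s\<^sup>2) ^ i) = (\<Sum>k\<le>m. s ^ (k * (k - 1)) * qbinom (s\<^sup>2) m k * y ^ k)"
proof (induction m)
  case 0
  then show ?case by (simp add: qbinom_def qpoch_def)
next
  case (Suc m)
  define p where "p = s\<^sup>2"
  define c where "c = (\<lambda>m k. s ^ (k * (k - 1)) * qbinom p m k)"
  have p: "norm p < 1" using assms by (simp add: p_def norm_power power_less_one_iff)
  \<comment> \<open>Absorbing the weight turns the factor p^(m - k) of the Pascal rule into p^m,
    independent of k, because k(k + 1) + 2(m - k) = k(k - 1) + 2m.\<close>
  have rec: "c (Suc m) (Suc k) = c m (Suc k) + p ^ m * c m k" if "k \<le> m" for k
  proof -
    have "s ^ (Suc k * k) * p ^ (m - k) = p ^ m * s ^ (k * (k - 1))"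
    proof (cases k)
      case 0
      then show ?thesis by simp
    next
      case (Suc l)
      with that obtain d where "m = k + d" using le_Suc_ex by blast
      then show ?thesis
        by (simp add: p_def Suc flip: power_mult power_add) (simp add: algebra_simps)
    qed
    then show ?thesis
      using qbinom_Suc_Suc[OF p that] by (simp add: c_def algebra_simps)
  qed
  have c0: "c (Suc m) 0 = c m 0"
    using qpoch_nonzero[OF p] by (simp add: c_def qbinom_def)
  have cm: "c m (Suc m) = 0" by (simp add: c_def qbinom_def)
  have "(\<Sum>k\<le>Suc m. c (Suc m) k * y ^ k) = c m 0 + (\<Sum>k\<le>m. (c m (Suc k) + p ^ m * c m k) * y ^ Suc k)"
    by (subst sum.atMost_Suc_shift) (simp add: rec c0)
  also have "\<dots> = (\<Sum>k\<le>Suc m. c m k * y ^ k) + y * p ^ m * (\<Sum>k\<le>m. c m k * y ^ k)"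
    using sum.atMost_Suc_shift[of "\<lambda>k. c m k * y ^ k" m]
    by (simp add: sum.distrib sum_distrib_left algebra_simps del: sum.atMost_Suc)
  also have "\<dots> = (\<Sum>k\<le>m. c m k * y ^ k) * (1 + y * p ^ m)"
    by (simp add: cm algebra_simps)
  finally show ?case
    using Suc by (simp add: c_def p_def)
qed

section \<open>The finite triple product and its limit\<close>

definition theta_prod :: "complex \<Rightarrow> nat \<Rightarrow> complex \<Rightarrow> complex" where
  "theta_prod p n x = (\<Prod>i<n. (1 - x * p ^ i) * (1 - p ^ Suc i / x))"

text \<open>The q-binomial of 2n over n + k, extended by zero, so that a finite sum becomes a sum
  over all integers to which dominated convergence applies.\<close>

definition theta_coeff :: "complex \<Rightarrow> nat \<Rightarrow> int \<Rightarrow> complex" where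
  "theta_coeff p n k = (if \<bar>k\<bar> \<le> int n
     then qpoch p (2 * n) / (qpoch p (nat (int n + k)) * qpoch p (nat (int n - k))) else 0)"

lemma prod_power_Suc: "(\<Prod>i<n. (s\<^sup>2) ^ Suc i) = (s::complex) ^ (n * (n + 1))"
  by (induction n) (auto simp: algebra_simps power2_eq_square power_add power_mult_distrib simp flip: power_mult)

lemma theta_prod_eq_sum:
  assumes "s \<noteq> 0" "norm s < 1" "x \<noteq> 0"
  shows "theta_prod (s\<^sup>2) n x =
    (\<Sum>k\<in>{-int n..int n}. (-1) powi k * s powi (k * (k - 1)) * x powi k * theta_coeff (s\<^sup>2) n k)"
proof -
  define p where "p = s\<^sup>2"
  have p0: "p \<noteq> 0" using assms by (simp add: p_def)
  \<comment> \<open>With 2n factors and this y, Gauss's formula becomes symmetric: the factors n to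
    2n - 1 are 1 - x p^i, and the first n, in reverse order, are 1 - x / p^(i+1), which equals -x /
    p^(i+1) times 1 - p^(i+1) / x.\<close>
  define y where "y = - x / p ^ n"
  have "(\<Prod>i<2*n. 1 + y * p ^ i) = (\<Prod>i<n. 1 + y * p ^ i) * (\<Prod>i<n. 1 - x * p ^ i)"
  proof -
    have "(\<Prod>i<2*n. 1 + y * p ^ i) = (\<Prod>i<n. 1 + y * p ^ i) * (\<Prod>i\<in>{n..<n+n}. 1 + y * p ^ i)"
      using prod.atLeastLessThan_concat[of 0 n "n + n" "\<lambda>i. 1 + y * p ^ i"]
      by (simp add: mult_2 atLeast0LessThan)
    also have "(\<Prod>i\<in>{n..<n+n}. 1 + y * p ^ i) = (\<Prod>i<n. 1 + y * p ^ (i + n))"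
      using prod.shift_bounds_nat_ivl[of "\<lambda>i. 1 + y * p ^ i" 0 n n] by (simp add: atLeast0LessThan)
    also have "\<dots> = (\<Prod>i<n. 1 - x * p ^ i)"
      using p0 by (simp add: y_def power_add)
    finally show ?thesis .
  qed
  also have "(\<Prod>i<n. 1 + y * p ^ i) = (\<Prod>i<n. 1 + y * p ^ (n - Suc i))"
    by (rule prod.nat_diff_reindex[symmetric])
  also have "\<dots> = (\<Prod>i<n. (- x) * inverse (p ^ Suc i) * (1 - p ^ Suc i / x))"
  proof (rule prod.cong, goal_cases)
    case (2 i)
    then have "p ^ n = p ^ (n - Suc i) * p ^ Suc i"
      by (simp del: power_Suc flip: power_add)
    then show ?case using assms p0 by (simp add: y_def field_simps del: power_Suc)
  qed auto
  also have "\<dots> = (- x) ^ n * inverse (s ^ (n * (n + 1))) * (\<Prod>i<n. 1 - p ^ Suc i / x)"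
    unfolding prod.distrib using prod_inversef[of "\<lambda>i. p ^ Suc i" "{..<n}"] prod_power_Suc[of s n]
    by (simp add: p_def o_def del: power_Suc)
  finally have 1: "(\<Prod>i<2*n. 1 + y * p ^ i) = (- x) ^ n * inverse (s ^ (n * (n + 1))) * theta_prod p n x"
    by (simp add: theta_prod_def prod.distrib mult_ac)
  have "(\<Prod>i<2*n. 1 + y * p ^ i) = (\<Sum>k\<le>2*n. s ^ (k * (k - 1)) * qbinom p (2*n) k * y ^ k)"
    unfolding p_def by (rule gauss_binomial[OF assms(2)])
  also have "\<dots> = (\<Sum>k\<in>{-int n..int n}. (- x) ^ n * inverse (s ^ (n * (n + 1))) *
     ((-1) powi k * s powi (k * (k - 1)) * x powi k * theta_coeff p n k))"
  proof (rule sum.reindex_bij_witness[of _ "\<lambda>k. nat (k + int n)" "\<lambda>k. int k - int n"], goal_cases)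
    case (5 k)
    then have k: "k \<le> 2 * n" by simp
    define l where "l = int k - int n"
    have e1: "s ^ (k * (k - 1)) = s powi (int k * (int k - 1))"
    proof (cases k)
      case (Suc k')
      then have "int k * (int k - 1) = int (k * (k - 1))" by (simp add: algebra_simps)
      then show ?thesis by (simp only: power_int_of_nat)
    qed auto
    have e2: "y ^ k = (- x) powi (int k) * s powi (- 2 * int n * int k)"
    proof -
      have "y ^ k = (- x) ^ k / (s ^ (2 * n * k))"
        by (simp add: y_def p_def power_divide power_minus[of "x / _"] flip: power_mult)
           (simp add: power_minus' power_divide power_mult mult_ac flip: power_mult)
      also have "\<dots> = (- x) powi (int k) * s powi (- int (2 * n * k))"
        by (simp only: power_int_minus power_int_of_nat divide_inverse)
      finally show ?thesis by simp
    qed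
    have e3: "inverse (s ^ (n * (n + 1))) = s powi (- (int n * (int n + 1)))"
    proof -
      have "s powi (- int (n * (n + 1))) = inverse (s ^ (n * (n + 1)))"
        by (simp only: power_int_minus power_int_of_nat)
      then show ?thesis by (simp add: algebra_simps)
    qed
    have e4: "(- x) powi (int k) = (- x) ^ n * ((-1) powi l * x powi l)"
    proof -
      have "(- x) powi (int k) = (- x) powi (int n + l)" by (simp add: l_def)
      also have "\<dots> = (- x) ^ n * (- x) powi l"
        using assms by (subst power_int_add) auto
      also have "(- x) powi l = (-1) powi l * x powi l"
        by (metis mult_minus1 power_int_mult_distrib)
      finally show ?thesis .
    qed
    have e5: "s powi (int k * (int k - 1)) * s powi (- 2 * int n * int k) =
        s powi (- (int n * (int n + 1))) * s powi (l * (l - 1))"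
      using assms by (simp add: l_def algebra_simps flip: power_int_add)
    have e6: "theta_coeff p n l = qbinom p (2*n) k"
    proof -
      have "nat (int n + l) = k" "nat (int n - l) = 2 * n - k" "\<bar>l\<bar> \<le> int n"
        using k by (auto simp: l_def)
      then show ?thesis using k by (simp add: theta_coeff_def qbinom_def)
    qed
    have "s ^ (k * (k - 1)) * qbinom p (2 * n) k * y ^ k =
      (s powi (int k * (int k - 1)) * s powi (- 2 * int n * int k)) * theta_coeff p n l * ((- x) ^ n * ((-1) powi l * x powi l))"
      unfolding e1 e2 e4 e6 by (simp add: mult_ac)
    then show ?case unfolding e5 e3 l_def[symmetric] by (simp add: mult_ac)
  qed auto
  finally have "(- x) ^ n * inverse (s ^ (n * (n + 1))) * theta_prod p n x = \<dots>"
    unfolding 1 .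
  then show ?thesis
    using assms by (simp add: sum_distrib_left[symmetric] p_def)
qed

lemma theta_coeff_bounded:
  assumes "norm p < 1"
  obtains K where "K > 0" "\<And>n k. norm (theta_coeff p n k) \<le> K"
proof -
  obtain K where K: "K > 0" "\<And>n. norm (qpoch p n) \<le> K" "\<And>n. norm (inverse (qpoch p n)) \<le> K"
    using qpoch_bounded[OF assms] by metis
  have "norm (theta_coeff p n k) \<le> K * K * K" for n k
    using K by (auto simp: theta_coeff_def divide_inverse norm_mult mult.assoc[symmetric] intro!: mult_mono)
  then show ?thesis using K(1) by (intro that[of "K * K * K"]) auto
qed

lemma theta_coeff_tendsto:
  assumes "norm p < 1"
  shows "(\<lambda>n. theta_coeff p n k) \<longlonglongrightarrow> inverse (euler p)"
proof -
  have l: "filterlim (\<lambda>n. nat (int n + j)) at_top sequentially" for j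
    unfolding filterlim_at_top
  proof
    fix Z show "eventually (\<lambda>n. Z \<le> nat (int n + j)) sequentially"
      using eventually_ge_at_top[of "Z + nat \<bar>j\<bar>"] by eventually_elim linarith
  qed
  have l2: "filterlim (\<lambda>n::nat. 2 * n) at_top sequentially"
    by (rule filterlim_subseq) (simp add: strict_mono_def)
  note q = qpoch_tendsto_euler[OF assms]
  have "(\<lambda>n. qpoch p (2 * n) / (qpoch p (nat (int n + k)) * qpoch p (nat (int n + - k)))) \<longlonglongrightarrow>
      euler p / (euler p * euler p)"
    by (intro tendsto_divide tendsto_mult filterlim_compose[OF q l] filterlim_compose[OF q l2])
       (use euler_nonzero[OF assms] in auto)
  moreover have "eventually (\<lambda>n. qpoch p (2 * n) / (qpoch p (nat (int n + k)) * qpoch p (nat (int n + - k)))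
     = theta_coeff p n k) sequentially"
    using eventually_ge_at_top[of "nat \<bar>k\<bar>"] by eventually_elim (auto simp: theta_coeff_def)
  ultimately show ?thesis
    using euler_nonzero[OF assms] by (simp add: tendsto_cong field_simps)
qed

lemma infsum_theta_coeff_tendsto:
  fixes h :: "int \<Rightarrow> complex"
  assumes p: "norm p < 1" and h: "h summable_on UNIV"
  shows "(\<lambda>n. \<Sum>k\<in>{-int n..int n}. h k * theta_coeff p n k) \<longlonglongrightarrow> infsum h UNIV / euler p"
proof -
  obtain K where K: "K > 0" "\<And>n k. norm (theta_coeff p n k) \<le> K"
    using theta_coeff_bounded[OF p] by metis
  have "(\<lambda>n. \<Sum>\<^sub>\<infinity>k. h k * theta_coeff p n k) \<longlonglongrightarrow> (\<Sum>\<^sub>\<infinity>k. h k * inverse (euler p))"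
  proof (rule infsum_dominated_convergence)
    show "(\<lambda>k. norm (h k) * K) summable_on UNIV"
      using h by (intro summable_on_cmult_left) (simp add: summable_on_iff_abs_summable_on_complex)
  qed (use K in \<open>auto simp: norm_mult intro!: mult_left_mono tendsto_intros theta_coeff_tendsto[OF p]\<close>)
  moreover have "(\<Sum>\<^sub>\<infinity>k. h k * theta_coeff p n k) = (\<Sum>k\<in>{-int n..int n}. h k * theta_coeff p n k)" for n
    by (subst infsum_cong_neutral[where T = "{-int n..int n}" and g = "\<lambda>k. h k * theta_coeff p n k"])
       (auto simp: theta_coeff_def)
  ultimately show ?thesis by (simp add: infsum_cmult_left' divide_inverse)
qed

lemma summable_on_theta_terms:
  fixes s x :: complex
  assumes "s \<noteq> 0" "norm s < 1" "x \<noteq> 0"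
  shows "(\<lambda>k::int. (-1) powi k * s powi (k * (k - 1)) * x powi k) summable_on UNIV"
proof -
  have "(\<lambda>k::int. s powi (k * k) * (- x / s) powi k) summable_on UNIV"
    using assms by (intro summable_on_gauss) auto
  also have "(\<lambda>k::int. s powi (k * k) * (- x / s) powi k) =
    (\<lambda>k::int. (-1) powi k * s powi (k * (k - 1)) * x powi k)"
    using assms by (auto simp: right_diff_distrib power_int_diff power_int_divide_distrib power_int_minus_left)
  finally show ?thesis .
qed

lemma theta_prod_tendsto:
  assumes "s \<noteq> 0" "norm s < 1" "x \<noteq> 0"
  shows "(\<lambda>n. theta_prod (s\<^sup>2) n x) \<longlonglongrightarrow> theta s x / euler (s\<^sup>2)"
  unfolding theta_prod_eq_sum[OF assms] theta_def
  by (rule infsum_theta_coeff_tendsto[OF _ summable_on_theta_terms[OF assms]])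
     (use assms in \<open>simp add: norm_power power_less_one_iff\<close>)

text \<open>The index i is split by parity. Of the factors 1 - x q^i the even ones belong to the
  product at x and the odd ones to that at q x; for the factors 1 - q^(i+1) / x it is the other way
  round.\<close>

lemma theta_prod_double:
  assumes "q \<noteq> 0"
  shows "theta_prod q (2 * n) x = theta_prod (q\<^sup>2) n x * theta_prod (q\<^sup>2) n (q * x)"
proof (induction n)
  case (Suc n)
  have "theta_prod q (2 * Suc n) x = theta_prod q (2 * n) x *
      ((1 - x * q ^ (2 * n)) * (1 - q * q ^ (2 * n) / x)) *
      ((1 - x * (q * q ^ (2 * n))) * (1 - q\<^sup>2 * q ^ (2 * n) / x))"
    by (simp add: theta_prod_def power2_eq_square mult_ac)
  moreover have "theta_prod (q\<^sup>2) (Suc n) y = theta_prod (q\<^sup>2) n y *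
      ((1 - y * q ^ (2 * n)) * (1 - q\<^sup>2 * q ^ (2 * n) / y))" for y
    by (simp add: theta_prod_def power_mult)
  moreover have "q\<^sup>2 * q ^ (2 * n) / (q * x) = q * q ^ (2 * n) / x"
    using assms by (simp add: power2_eq_square)
  ultimately show ?case by (simp only: mult_ac Suc.IH[unfolded mult.commute[of 2]])
qed (simp add: theta_prod_def)

lemma theta_half_nome:
  assumes "s \<noteq> 0" "norm s < 1" "x \<noteq> 0"
  shows "theta s x * euler (s^4) ^ 2 = euler (s\<^sup>2) * theta (s\<^sup>2) x * theta (s\<^sup>2) (s\<^sup>2 * x)"
proof -
  define q where "q = s\<^sup>2"
  have q: "q \<noteq> 0" "norm q < 1" "norm (q\<^sup>2) < 1"
    using assms by (auto simp: q_def norm_power power_less_one_iff)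
  have s4: "s ^ 4 = q\<^sup>2" by (simp add: q_def flip: power_mult)
  have "(\<lambda>n. theta_prod q (2 * n) x) \<longlonglongrightarrow> theta s x / euler q"
    by (rule filterlim_compose[OF theta_prod_tendsto[OF assms, folded q_def]])
       (rule filterlim_subseq, simp add: strict_mono_def)
  moreover have "(\<lambda>n. theta_prod q (2 * n) x) \<longlonglongrightarrow> theta q x / euler (q\<^sup>2) * (theta q (q * x) / euler (q\<^sup>2))"
    unfolding theta_prod_double[OF q(1)] using q assms by (intro tendsto_mult theta_prod_tendsto) auto
  ultimately have "theta s x / euler q = theta q x / euler (q\<^sup>2) * (theta q (q * x) / euler (q\<^sup>2))"
    by (rule LIMSEQ_unique)
  then show ?thesis
    using euler_nonzero[OF q(2)] euler_nonzero[OF q(3)]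
    unfolding s4 q_def[symmetric] by (simp add: field_simps power2_eq_square)
qed

text \<open>Jacobi's cube identity: the derivative of the theta series at its zero x = 1.
  Differentiation takes place on the finite products, so that no infinite series has to be
  differentiated termwise.\<close>

lemma has_sum_theta_derivative:
  assumes "s \<noteq> 0" "norm s < 1"
  shows "((\<lambda>k::int. (-1) powi k * s powi (k * (k - 1)) * of_int k) has_sum - (euler (s\<^sup>2) ^ 3)) UNIV"
proof -
  define p where "p = s\<^sup>2"
  have p: "norm p < 1" using assms by (auto simp: p_def norm_power power_less_one_iff)
  define h where "h = (\<lambda>k::int. (-1) powi k * s powi (k * (k - 1)) * of_int k)"
  have h: "h summable_on UNIV"
  proof (rule summable_on_norm_bound)
    have "(\<lambda>k::int. norm s powi (k * k) * (2 * (norm s + inverse (norm s))) ^ nat \<bar>k\<bar>) summable_on UNIV"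
      using assms by (intro summable_on_gauss_abs) auto
    then show "(\<lambda>k::int. norm s powi (k * k) * (2 * (norm s + inverse (norm s))) ^ nat \<bar>k\<bar>) summable_on UNIV" .
    fix k :: int
    have "norm s powi (- k) \<le> (norm s + inverse (norm s)) ^ nat \<bar>- k\<bar>"
      using assms by (intro power_int_le_nat_abs_power) auto
    moreover have "real_of_int \<bar>k\<bar> \<le> 2 ^ nat \<bar>k\<bar>"
      using of_nat_less_two_power[of "nat \<bar>k\<bar>", where 'a = real] by simp
    moreover have "norm s powi (k * (k - 1)) = norm s powi (k * k) * norm s powi (- k)"
      using assms by (simp add: right_diff_distrib flip: power_int_add)
    ultimately have "norm s powi (k * k) * norm s powi (- k) * real_of_int \<bar>k\<bar>
      \<le> norm s powi (k * k) * (norm s + inverse (norm s)) ^ nat \<bar>k\<bar> * 2 ^ nat \<bar>k\<bar>"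
      by (intro mult_mono) auto
    with \<open>norm s powi (k * (k - 1)) = _\<close>
    show "norm (h k) \<le> norm s powi (k * k) * (2 * (norm s + inverse (norm s))) ^ nat \<bar>k\<bar>"
      unfolding h_def norm_mult norm_power_int power_mult_distrib by (simp add: mult_ac)
  qed
  have eq: "(\<Sum>k\<in>{-int (Suc n)..int (Suc n)}. h k * theta_coeff p (Suc n) k) = - (qpoch p n * qpoch p (Suc n))" for n
  proof -
    \<comment> \<open>\<open>R\<close> is the product without its vanishing factor 1 - x, which
      exists because the length is \<open>Suc n\<close>; Caratheodory's form of the derivative then
      reads off -R(1).\<close>
    define R where "R = (\<lambda>x. (\<Prod>i<n. 1 - x * p ^ Suc i) * (\<Prod>i<Suc n. 1 - p ^ Suc i / x))"
    have tp: "theta_prod p (Suc n) x = (1 - x) * R x" for x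
      unfolding theta_prod_def prod.distrib R_def
      by (subst prod.lessThan_Suc_shift) simp
    have "(theta_prod p (Suc n) has_field_derivative - R 1) (at 1)"
      unfolding CARAT_DERIV
    proof (intro exI[of _ "\<lambda>x. - R x"] conjI allI)
      show "isCont (\<lambda>x. - R x) 1" unfolding R_def by (intro continuous_intros) auto
    qed (simp_all add: tp algebra_simps)
    moreover have "(theta_prod p (Suc n) has_field_derivative
        (\<Sum>k\<in>{-int (Suc n)..int (Suc n)}. h k * theta_coeff p (Suc n) k)) (at 1)"
    proof (rule has_field_derivative_transform_within_open)
      show "((\<lambda>x. \<Sum>k\<in>{-int (Suc n)..int (Suc n)}. (-1) powi k * s powi (k * (k - 1)) * x powi k * theta_coeff p (Suc n) k)
        has_field_derivative (\<Sum>k\<in>{-int (Suc n)..int (Suc n)}. h k * theta_coeff p (Suc n) k)) (at 1)"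
        by (auto intro!: derivative_eq_intros sum.cong simp: h_def)
      show "open (- {0 :: complex})" by auto
    qed (use theta_prod_eq_sum[OF assms] in \<open>auto simp: p_def\<close>)
    moreover have "R 1 = qpoch p n * qpoch p (Suc n)"
      by (simp add: R_def qpoch_def)
    ultimately show ?thesis using DERIV_unique by metis
  qed
  have "(\<lambda>n. \<Sum>k\<in>{-int (Suc n)..int (Suc n)}. h k * theta_coeff p (Suc n) k) \<longlonglongrightarrow> infsum h UNIV / euler p"
    by (rule LIMSEQ_Suc[OF infsum_theta_coeff_tendsto[OF p h]])
  moreover have "(\<lambda>n. - (qpoch p n * qpoch p (Suc n))) \<longlonglongrightarrow> - (euler p * euler p)"
    by (intro tendsto_intros LIMSEQ_Suc qpoch_tendsto_euler[OF p])
  ultimately have "infsum h UNIV / euler p = - (euler p * euler p)"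
    unfolding eq using LIMSEQ_unique by blast
  then have "infsum h UNIV = - (euler p ^ 3)"
    using euler_nonzero[OF p] by (simp add: field_simps power3_eq_cube)
  then show ?thesis
    using h has_sum_infsum[OF h] by (simp add: h_def p_def)
qed

section \<open>The reciprocal of a theta function\<close>

text \<open>Up to \<open>euler (s\<^sup>2) ^ 3\<close> these partial theta values are the Laurent coefficients of
  \<open>1 / theta s x\<close> in the annulus \<open>norm s ^ 2 < norm x < 1\<close>.\<close>
definition ptheta :: "complex \<Rightarrow> int \<Rightarrow> complex" where
  "ptheta s j = (\<Sum>\<^sub>\<infinity>k\<in>{0..}. (-1) powi k * s powi (k * (k + 1) + 2 * k * j))"

lemma summable_on_ptheta_terms:
  fixes s :: complex
  assumes "s \<noteq> 0" "norm s < 1"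
  shows "(\<lambda>k::int. (-1) powi k * s powi (k * (k + 1) + 2 * k * j)) summable_on A"
proof -
  have "(\<lambda>k::int. (-1) powi k * s powi (k * (k - 1)) * (s powi (2 + 2 * j)) powi k) summable_on UNIV"
    using assms by (intro summable_on_theta_terms) auto
  also have "(\<lambda>k::int. (-1) powi k * s powi (k * (k - 1)) * (s powi (2 + 2 * j)) powi k) =
      (\<lambda>k::int. (-1) powi k * s powi (k * (k + 1) + 2 * k * j))"
    using assms by (auto simp: algebra_simps simp flip: power_int_mult power_int_add)
  finally show ?thesis by (rule summable_on_subset) auto
qed

lemma ptheta_has_sum:
  assumes "s \<noteq> 0" "norm s < 1"
  shows "((\<lambda>k. (-1) powi k * s powi (k * (k + 1) + 2 * k * j)) has_sum ptheta s j) {0..}"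
  unfolding ptheta_def by (rule has_sum_infsum[OF summable_on_ptheta_terms[OF assms]])

text \<open>Under k -> -1 - 2j - k the exponent is unchanged and the sign flips, so the bilateral
  sum vanishes. Having both halves at hand lets later sums run on whichever side converges.\<close>

lemma ptheta_has_sum_neg:
  assumes "s \<noteq> 0" "norm s < 1"
  shows "((\<lambda>k. - ((-1) powi k * s powi (k * (k + 1) + 2 * k * j))) has_sum ptheta s j) {..<0}"
proof -
  have "ptheta s j = - (\<Sum>\<^sub>\<infinity>k\<in>{..<0}. (-1) powi k * s powi (k * (k + 1) + 2 * k * j))"
    unfolding ptheta_def
  proof (rule infsum_antisymmetric_half[of _ "- 1 - 2 * j"])
    fix k :: int
    have "(-1 - 2 * j - k) * (-1 - 2 * j - k + 1) + 2 * (-1 - 2 * j - k) * j = k * (k + 1) + 2 * k * j"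
      by (simp add: algebra_simps)
    moreover have "(-1 :: complex) powi (-1 - 2 * j - k) = - ((-1) powi k)"
      by (simp add: power_int_minus_left)
    ultimately show "(-1) powi (-1 - 2 * j - k) * s powi ((-1 - 2 * j - k) * (-1 - 2 * j - k + 1) + 2 * (-1 - 2 * j - k) * j) =
        - ((-1) powi k * s powi (k * (k + 1) + 2 * k * j))" by simp
  qed (rule summable_on_ptheta_terms[OF assms])
  then show ?thesis
    using has_sum_infsum[OF summable_on_ptheta_terms[OF assms]] by (auto intro: has_sum_uminusI)
qed

lemma ptheta_minus:
  assumes "s \<noteq> 0" "norm s < 1"
  shows "ptheta s (- j) = s powi (2 * j) * ptheta s j"
proof -
  have "((\<lambda>k. - ((-1) powi k * s powi (k * (k + 1) + 2 * k * (- j)))) has_sum ptheta s (- j)) {..<0}"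
    by (rule ptheta_has_sum_neg[OF assms])
  also have "?this \<longleftrightarrow> ((\<lambda>k. s powi (2 * j) * ((-1) powi k * s powi (k * (k + 1) + 2 * k * j))) has_sum ptheta s (- j)) {0..}"
  proof (rule has_sum_reindex_bij_witness[of _ "\<lambda>k. -1 - k" "\<lambda>k. -1 - k"])
    fix k :: int
    have "(-1 :: complex) powi (-1 - k) = - ((-1) powi k)" by (simp add: power_int_minus_left)
    moreover have "2 * j + ((-1 - k) * (-1 - k + 1) + 2 * (-1 - k) * j) = k * (k + 1) + 2 * k * - j"
      by (simp add: algebra_simps)
    then have "s powi (2 * j) * s powi ((-1 - k) * (-1 - k + 1) + 2 * (-1 - k) * j) = s powi (k * (k + 1) + 2 * k * - j)"
      using assms by (metis power_int_add)
    ultimately show "s powi (2 * j) * ((-1) powi (-1 - k) * s powi ((-1 - k) * (-1 - k + 1) + 2 * (-1 - k) * j)) =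
      - ((-1) powi k * s powi (k * (k + 1) + 2 * k * - j))"
      by (simp add: mult_ac)
  qed auto
  finally have "((\<lambda>k. s powi (2 * j) * ((-1) powi k * s powi (k * (k + 1) + 2 * k * j))) has_sum ptheta s (- j)) {0..}" .
  moreover have "((\<lambda>k. s powi (2 * j) * ((-1) powi k * s powi (k * (k + 1) + 2 * k * j))) has_sum (s powi (2 * j) * ptheta s j)) {0..}"
    by (rule has_sum_cmult_right[OF ptheta_has_sum[OF assms]])
  ultimately show ?thesis by (rule has_sum_unique)
qed

text \<open>The map k -> -k sends the terms with k > 0 to the negative half-line at index -j - 1;
  the 1 is the term k = 0.\<close>

lemma ptheta_reflect:
  assumes "s \<noteq> 0" "norm s < 1"
  shows "ptheta s j = 1 - ptheta s (- j - 1)"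
proof -
  have "((\<lambda>k. (-1) powi k * s powi (k * (k + 1) + 2 * k * j)) has_sum (ptheta s j - 1)) ({0..} - {0})"
    by (rule has_sum_Diff[OF ptheta_has_sum[OF assms]]) (auto intro!: has_sum_finiteI)
  also have "?this \<longleftrightarrow> ((\<lambda>k. (-1) powi k * s powi (k * (k + 1) + 2 * k * (- j - 1))) has_sum (ptheta s j - 1)) {..<0}"
  proof (rule has_sum_reindex_bij_witness[of _ "\<lambda>k. - k" "\<lambda>k. - k"])
    fix k :: int
    have "(- k) * (- k + 1) + 2 * (- k) * (- j - 1) = k * (k + 1) + 2 * k * j"
      by (simp add: algebra_simps)
    then show "(-1) powi (- k) * s powi ((- k) * (- k + 1) + 2 * (- k) * (- j - 1)) = (-1) powi k * s powi (k * (k + 1) + 2 * k * j)"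
      by (simp add: power_int_minus_one_minus)
  qed auto
  finally have "((\<lambda>k. - ((-1) powi k * s powi (k * (k + 1) + 2 * k * (- j - 1)))) has_sum - (ptheta s j - 1)) {..<0}"
    by (rule has_sum_uminusI)
  then show ?thesis
    using has_sum_unique[OF ptheta_has_sum_neg[OF assms, of "- j - 1"]] by fastforce
qed

text \<open>For j >= 0 the exponents only grow with j, so j = 0 dominates; negative j are reduced to
  this by \<open>ptheta_minus\<close>. The factor gained there determines the inner radius
  \<open>norm s ^ 2\<close> of the annulus of convergence.\<close>

lemma ptheta_bounded:
  assumes "s \<noteq> 0" "norm s < 1"
  obtains K where "K > 0" "\<And>j. j \<ge> 0 \<Longrightarrow> norm (ptheta s j) \<le> K"
    "\<And>j. j < 0 \<Longrightarrow> norm (ptheta s j) \<le> K * norm s powi (- 2 * j)"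
proof -
  define K where "K = (\<Sum>\<^sub>\<infinity>k\<in>{0..}. norm ((-1) powi k * s powi (k * (k + 1) + 2 * k * 0))) + 1"
  have "norm (ptheta s j) \<le> (\<Sum>\<^sub>\<infinity>k\<in>{0..}. norm ((-1) powi k * s powi (k * (k + 1) + 2 * k * 0)))" if "j \<ge> 0" for j
  proof (rule norm_infsum_le[OF ptheta_has_sum[OF assms]])
    show "((\<lambda>k. norm ((-1) powi k * s powi (k * (k + 1) + 2 * k * 0))) has_sum
      (\<Sum>\<^sub>\<infinity>k\<in>{0..}. norm ((-1) powi k * s powi (k * (k + 1) + 2 * k * 0)))) {0..}"
      using summable_on_ptheta_terms[OF assms, of 0 "{0..}"]
      by (intro has_sum_infsum) (simp only: summable_on_iff_abs_summable_on_complex)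
    fix k :: int assume "k \<in> {0..}"
    then have "norm s powi (k * (k + 1) + 2 * k * j) \<le> norm s powi (k * (k + 1) + 2 * k * 0)"
      using assms that by (intro power_int_decreasing) auto
    then show "norm ((-1) powi k * s powi (k * (k + 1) + 2 * k * j)) \<le> norm ((-1) powi k * s powi (k * (k + 1) + 2 * k * 0))"
      by (simp add: norm_mult norm_power_int)
  qed
  then have 1: "norm (ptheta s j) \<le> K" if "j \<ge> 0" for j
    using that by (force simp: K_def)
  have "K > 0" unfolding K_def by (intro add_nonneg_pos infsum_nonneg) auto
  moreover have "norm (ptheta s j) \<le> K * norm s powi (- 2 * j)" if "j < 0" for j
  proof -
    have "norm (ptheta s j) = norm s powi (- 2 * j) * norm (ptheta s (- j))"
      using ptheta_minus[OF assms, of "- j"] by (simp add: norm_mult norm_power_int)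
    then show ?thesis using 1[of "- j"] that by (simp add: mult.commute mult_right_mono)
  qed
  ultimately show ?thesis using 1 that by blast
qed

lemma summable_on_ptheta_laurent:
  assumes "s \<noteq> 0" "norm s ^ 2 < norm x" "norm x < 1"
  shows "(\<lambda>j. ptheta s j * x powi j) summable_on UNIV"
proof -
  have s: "norm s < 1"
    using assms power_less_one_iff[of "norm s" 2] by force
  obtain K where K: "K > 0" "\<And>j. j \<ge> 0 \<Longrightarrow> norm (ptheta s j) \<le> K"
    "\<And>j. j < 0 \<Longrightarrow> norm (ptheta s j) \<le> K * norm s powi (- 2 * j)"
    using ptheta_bounded[OF assms(1) s] by metis
  have x: "norm x > 0" using assms by (smt (verit) zero_le_power2)
  define d where "d = max (norm x) (norm s ^ 2 / norm x)"
  have d: "0 < d" "d < 1" using assms x by (auto simp: d_def less_max_iff_disj field_simps)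
  have "(\<lambda>j. norm (ptheta s j * x powi j)) summable_on UNIV"
  proof (rule summable_on_int_nat_abs_bound[of "\<lambda>n. K * d ^ n"])
    show "summable (\<lambda>n. K * d ^ n)" using d by (intro summable_mult summable_geometric) auto
    fix j :: int
    show "norm (ptheta s j * x powi j) \<le> K * d ^ nat \<bar>j\<bar>"
    proof (cases "j \<ge> 0")
      case True
      have "norm x ^ nat j \<le> d ^ nat j" by (intro power_mono) (auto simp: d_def)
      then show ?thesis using K True x
        by (auto simp: norm_mult norm_power power_int_def intro!: mult_mono)
    next
      case False
      have "norm (ptheta s j * x powi j) \<le> K * (norm s powi (- 2 * j) * norm x powi j)"
        unfolding norm_mult norm_power_int mult.assoc[symmetric]
        using K False by (intro mult_right_mono) auto
      also have "norm s powi (- 2 * j) * norm x powi j = (norm s ^ 2 / norm x) ^ nat \<bar>j\<bar>"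
      proof -
        obtain m where "j = - int m" using False by (metis int_cases2 linorder_not_le of_nat_0_le_iff order.strict_iff_not)
        then show ?thesis
          by (simp add: power_int_minus power_int_mult power_mult divide_inverse power_mult_distrib power_inverse)
      qed
      also have "\<dots> \<le> d ^ nat \<bar>j\<bar>" by (intro power_mono) (auto simp: d_def)
      finally show ?thesis using K(1) by simp
    qed
  qed auto
  then show ?thesis by (simp only: summable_on_iff_abs_summable_on_complex)
qed

section \<open>Convolution of theta with partial theta coefficients\<close>

lemma theta_has_sum:
  assumes "s \<noteq> 0" "norm s < 1" "x \<noteq> 0"
  shows "((\<lambda>k. (-1) powi k * s powi (k * (k - 1)) * x powi k) has_sum theta s x) UNIV"
  unfolding theta_def by (rule has_sum_infsum[OF summable_on_theta_terms[OF assms]])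

lemma theta_one:
  assumes "s \<noteq> 0" "norm s < 1" shows "theta s 1 = 0"
  unfolding theta_def
proof (rule infsum_antisymmetric[of _ 1])
  fix k :: int
  have "(1 - k) * (1 - k - 1) = k * (k - 1)" by (simp add: algebra_simps)
  then show "(-1) powi (1 - k) * s powi ((1 - k) * (1 - k - 1)) * 1 powi (1 - k) =
    - ((-1) powi k * s powi (k * (k - 1)) * 1 powi k)"
    by (simp add: power_int_minus_left)
qed (rule summable_on_theta_terms[OF assms one_neq_zero])

text \<open>Replacing i by i + k turns the exponent into 2kK + i(i - 1): the variables separate and
  the sum over i is theta(1) = 0. The set \<open>A\<close> is left open because the remaining
  geometric series in k converges only on the half-line that matches the sign of K.\<close>

lemma theta_ptheta_convolution_aux:
  fixes s :: complex
  assumes s: "s \<noteq> 0" "norm s < 1" and A: "(\<lambda>k. s powi (2 * k * K)) summable_on A"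
    and g: "\<And>i. ((\<lambda>k. (-1) powi k * s powi (k * (k + 1) + 2 * k * (K - i))) has_sum g i) A"
  shows "((\<lambda>i. (-1) powi i * s powi (i * (i - 1)) * g i) has_sum 0) UNIV"
proof -
  have "((\<lambda>(k,i). s powi (2 * k * K) * ((-1) powi i * s powi (i * (i - 1)) * 1 powi i)) has_sum
      (infsum (\<lambda>k. s powi (2 * k * K)) A * theta s 1)) (A \<times> UNIV)"
    by (rule has_sum_times[OF has_sum_infsum[OF A] theta_has_sum[OF s]]) auto
  then have "((\<lambda>(k,i). s powi (2 * k * K) * ((-1) powi i * s powi (i * (i - 1)))) has_sum 0) (A \<times> UNIV)"
    by (simp add: theta_one[OF s])
  also have "?this \<longleftrightarrow> ((\<lambda>(i,k). (-1) powi i * s powi (i * (i - 1)) *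
      ((-1) powi k * s powi (k * (k + 1) + 2 * k * (K - i)))) has_sum 0) (UNIV \<times> A)"
  proof (rule has_sum_reindex_bij_witness[of _ "\<lambda>(i,k). (k, i - k)" "\<lambda>(k,i). (i + k, k)"])
    fix a :: "int \<times> int"
    obtain k i where a: "a = (k, i)" by (cases a)
    have "(i + k) * (i + k - 1) + (k * (k + 1) + 2 * k * (K - (i + k))) = 2 * k * K + i * (i - 1)"
      by (simp add: algebra_simps)
    then have "s powi ((i + k) * (i + k - 1)) * s powi (k * (k + 1) + 2 * k * (K - (i + k))) = s powi (2 * k * K) * s powi (i * (i - 1))"
      using s by (metis power_int_add)
    moreover have "(-1 :: complex) powi (i + k) * (-1) powi k = (-1) powi i"
      by (simp add: power_int_minus_left)
    ultimately have "((-1) powi (i + k) * (-1) powi k) * (s powi ((i + k) * (i + k - 1)) * s powi (k * (k + 1) + 2 * k * (K - (i + k))))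
       = (-1) powi i * (s powi (2 * k * K) * s powi (i * (i - 1)))" by simp
    then show "(case case a of (k, i) \<Rightarrow> (i + k, k) of (i, k) \<Rightarrow> (-1) powi i * s powi (i * (i - 1)) *
      ((-1) powi k * s powi (k * (k + 1) + 2 * k * (K - i)))) = (case a of (k, i) \<Rightarrow> s powi (2 * k * K) * ((-1) powi i * s powi (i * (i - 1))))"
      by (simp add: a mult_ac)
  qed auto
  finally show ?thesis
    by (rule has_sum_SigmaD) (use has_sum_cmult_right[OF g] in simp)
qed

lemma summable_on_int_geometric:
  fixes y :: complex assumes "norm y < 1"
  shows "(\<lambda>k::int. y powi k) summable_on {0..}"
proof -
  have "(\<lambda>n. y ^ n) summable_on UNIV"
    using assms by (intro norm_summable_imp_summable_on) (simp add: norm_power summable_geometric)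
  also have "?this \<longleftrightarrow> (\<lambda>k::int. y powi k) summable_on {0..}"
    by (rule summable_on_reindex_bij_witness[of _ nat int]) auto
  finally show ?thesis .
qed

lemma theta_ptheta_convolution_nonzero:
  assumes s: "s \<noteq> 0" "norm s < 1" and "K \<noteq> 0"
  shows "((\<lambda>i. (-1) powi i * s powi (i * (i - 1)) * ptheta s (K - i)) has_sum 0) UNIV"
proof (cases "K > 0")
  case True
  have "norm (s powi (2 * K)) < 1"
    using s True by (simp add: norm_power power_int_def power_less_one_iff)
  then have "(\<lambda>k::int. (s powi (2 * K)) powi k) summable_on {0..}"
    by (rule summable_on_int_geometric)
  then have "(\<lambda>k::int. s powi (2 * k * K)) summable_on {0..}"
    by (simp add: mult_ac flip: power_int_mult)
  then show ?thesis
    by (rule theta_ptheta_convolution_aux[OF s _ ptheta_has_sum[OF s]])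
next
  case False
  with \<open>K \<noteq> 0\<close> have K: "K < 0" by simp
  have "norm (s powi (- 2 * K)) < 1"
    using s K by (simp add: norm_power power_int_def power_less_one_iff)
  then have "(\<lambda>k::int. (s powi (- 2 * K)) powi k) summable_on {0..}"
    by (rule summable_on_int_geometric)
  then have "(\<lambda>k::int. (s powi (- 2 * K)) powi k) summable_on {1..}"
    by (rule summable_on_subset) auto
  also have "?this \<longleftrightarrow> (\<lambda>k::int. s powi (2 * k * K)) summable_on {..<0}"
    by (rule summable_on_reindex_bij_witness[of _ "\<lambda>k. - k" "\<lambda>k. - k"]) (auto simp: mult_ac simp flip: power_int_mult)
  finally have "((\<lambda>i. (-1) powi i * s powi (i * (i - 1)) * (- ptheta s (K - i))) has_sum 0) UNIV"
    by (rule theta_ptheta_convolution_aux[OF s])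
       (use has_sum_uminusI[OF ptheta_has_sum_neg[OF s]] in simp)
  then show ?thesis using has_sum_uminusI by fastforce
qed

text \<open>At K = 0 the geometric series is constantly 1, so no fixed half-line for k converges.
  Here the half-line depends on the sign of i instead; grouping by m = k - i + 1 gives finite fibres
  of size \<bar>m\<bar>, and their signs combine to the weight -m of Jacobi's sum.\<close>

lemma theta_ptheta_convolution_zero:
  assumes s: "s \<noteq> 0" "norm s < 1"
  shows "((\<lambda>i. (-1) powi i * s powi (i * (i - 1)) * ptheta s (- i)) has_sum (euler (s\<^sup>2) ^ 3)) UNIV"
proof -
  \<comment> \<open>\<open>J i\<close> is the half-line of k allotted to i, and \<open>I m\<close>
    the fibre of indices i over m = k - i + 1. Pairs with i <= 0 and k >= 0 land in m > 0, those
    with i > 0 and k < 0 in m < 0; \<open>I 0\<close> is empty.\<close>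
  define I :: "int \<Rightarrow> int set" where "I = (\<lambda>m. if m > 0 then {1-m..0} else {1..-m})"
  define J :: "int \<Rightarrow> int set" where "J = (\<lambda>i. if i \<le> 0 then {0..} else {..<0})"
  define F where "F = (\<lambda>(m::int, i::int). (if i \<le> 0 then -1 else 1) * ((-1) powi m * s powi (m * (m - 1))))"
  define h where "h = (\<lambda>m::int. (-1) powi m * s powi (m * (m - 1)) * of_int m)"
  have h: "(h has_sum - (euler (s\<^sup>2) ^ 3)) UNIV"
    unfolding h_def by (rule has_sum_theta_derivative[OF s])
  have inner: "((\<lambda>i. F (m, i)) has_sum (- h m)) (I m)" for m
    by (rule has_sum_finiteI) (auto simp: I_def F_def h_def)
  have inner_norm: "((\<lambda>i. norm (F (m, i))) has_sum norm (h m)) (I m)" for m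
    by (rule has_sum_finiteI) (auto simp: I_def F_def h_def norm_mult norm_power_int)
  have "(\<lambda>x. norm (F x)) summable_on Sigma UNIV I"
    using inner_norm has_sum_imp_summable[OF h]
    by (intro summable_on_SigmaI[where g = "\<lambda>m. norm (h m)"]) (auto simp: summable_on_iff_abs_summable_on_complex)
  then have "F summable_on Sigma UNIV I"
    by (simp only: summable_on_iff_abs_summable_on_complex)
  then have "(F has_sum (euler (s\<^sup>2) ^ 3)) (Sigma UNIV I)"
    using inner has_sum_uminusI[OF h] by (intro has_sum_SigmaI[where g = "\<lambda>m. - h m"]) auto
  also have "?this \<longleftrightarrow> ((\<lambda>(i,k). (-1) powi i * s powi (i * (i - 1)) *
      ((if i \<le> 0 then 1 else -1) * ((-1) powi k * s powi (k * (k + 1) + 2 * k * (- i))))) has_sum (euler (s\<^sup>2) ^ 3)) (Sigma UNIV J)"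
  proof (rule has_sum_reindex_bij_witness[of _ "\<lambda>(i,k). (k - i + 1, i)" "\<lambda>(m,i). (i, m + i - 1)"])
    fix a :: "int \<times> int"
    obtain m i where a: "a = (m, i)" by (cases a)
    define k where "k = m + i - 1"
    have "i * (i - 1) + (k * (k + 1) + 2 * k * (- i)) = m * (m - 1)"
      by (simp add: k_def algebra_simps)
    then have "s powi (i * (i - 1)) * s powi (k * (k + 1) + 2 * k * (- i)) = s powi (m * (m - 1))"
      using s by (metis power_int_add)
    moreover have "(-1 :: complex) powi i * (-1) powi k = - ((-1) powi m)"
      by (simp add: power_int_minus_left k_def)
    ultimately have "((-1) powi i * (-1) powi k) * (s powi (i * (i - 1)) * s powi (k * (k + 1) + 2 * k * (- i)))
       = - ((-1) powi m * s powi (m * (m - 1)))" by simp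
    then show "(case case a of (m, i) \<Rightarrow> (i, m + i - 1) of (i,k) \<Rightarrow> (-1) powi i * s powi (i * (i - 1)) *
      ((if i \<le> 0 then 1 else -1) * ((-1) powi k * s powi (k * (k + 1) + 2 * k * (- i))))) = F a"
      by (simp add: a k_def[symmetric] mult_ac F_def)
  qed (auto simp: I_def J_def split: if_splits)
  finally show ?thesis
  proof (rule has_sum_SigmaD)
    fix i :: int
    have "((\<lambda>k. (if i \<le> 0 then 1 else -1) * ((-1) powi k * s powi (k * (k + 1) + 2 * k * (- i)))) has_sum ptheta s (- i)) (J i)"
      using ptheta_has_sum[OF s, of "- i"] ptheta_has_sum_neg[OF s, of "- i"] by (auto simp: J_def)
    from has_sum_cmult_right[OF this]
    show "((\<lambda>k. case (i, k) of (i,k) \<Rightarrow> (-1) powi i * s powi (i * (i - 1)) *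
      ((if i \<le> 0 then 1 else -1) * ((-1) powi k * s powi (k * (k + 1) + 2 * k * (- i))))) has_sum
      ((-1) powi i * s powi (i * (i - 1)) * ptheta s (- i))) (J i)" by simp
  qed
qed

lemma ptheta_laurent_times_theta:
  assumes "s \<noteq> 0" "norm s ^ 2 < norm x" "norm x < 1"
  shows "(\<Sum>\<^sub>\<infinity>j. ptheta s j * x powi j) * theta s x = euler (s\<^sup>2) ^ 3"
proof -
  have s: "s \<noteq> 0" "norm s < 1"
    using assms power_less_one_iff[of "norm s" 2] by force+
  have x: "x \<noteq> 0" using assms by auto
  define E where "E = (\<lambda>K::int. if K = 0 then euler (s\<^sup>2) ^ 3 else 0)"
  have E: "((\<lambda>i. (-1) powi i * s powi (i * (i - 1)) * ptheta s (K - i)) has_sum E K) UNIV" for K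
    using theta_ptheta_convolution_zero[OF s] theta_ptheta_convolution_nonzero[OF s, of K] by (simp add: E_def)
  have "((\<lambda>(j,i). ptheta s j * x powi j * ((-1) powi i * s powi (i * (i - 1)) * x powi i)) has_sum
     ((\<Sum>\<^sub>\<infinity>j. ptheta s j * x powi j) * theta s x)) (UNIV \<times> UNIV)"
    by (rule has_sum_times[OF has_sum_infsum[OF summable_on_ptheta_laurent[OF assms]] theta_has_sum[OF s x]])
  also have "?this \<longleftrightarrow> ((\<lambda>(K,i). x powi K * ((-1) powi i * s powi (i * (i - 1)) * ptheta s (K - i))) has_sum
     ((\<Sum>\<^sub>\<infinity>j. ptheta s j * x powi j) * theta s x)) (UNIV \<times> UNIV)"
    by (rule has_sum_reindex_bij_witness[of _ "\<lambda>(K,i). (K - i, i)" "\<lambda>(j,i). (j + i, i)"])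
       (use x in \<open>auto simp: power_int_add mult_ac\<close>)
  finally have "((\<lambda>K. x powi K * E K) has_sum ((\<Sum>\<^sub>\<infinity>j. ptheta s j * x powi j) * theta s x)) UNIV"
    by (rule has_sum_SigmaD) (use has_sum_cmult_right[OF E] in simp)
  moreover have "((\<lambda>K. x powi K * E K) has_sum (euler (s\<^sup>2) ^ 3)) UNIV"
    by (rule has_sum_finite_neutralI[of "{0}"]) (auto simp: E_def)
  ultimately show ?thesis by (rule has_sum_unique)
qed

lemma theta_nonzero:
  assumes "s \<noteq> 0" "norm s ^ 2 < norm x" "norm x < 1"
  shows "theta s x \<noteq> 0"
proof
  assume "theta s x = 0"
  moreover have "norm (s\<^sup>2) < 1" using assms by (simp add: norm_power)
  ultimately show False
    using ptheta_laurent_times_theta[OF assms] euler_nonzero[of "s\<^sup>2"] by simp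
qed

lemma theta_times_nome_nonzero:
  assumes "q \<noteq> 0" "norm q < norm x" "norm x < 1"
  shows "theta q (q * x) \<noteq> 0"
proof (rule theta_nonzero[OF assms(1)])
  show "norm q ^ 2 < norm (q * x)"
    using assms by (simp add: norm_mult power2_eq_square)
  show "norm (q * x) < 1"
    using mult_strict_mono[of "norm q" 1 "norm x" 1] assms by (simp add: norm_mult)
qed

section \<open>The Laurent expansion of the theta quotient\<close>

lemma theta_inverse:
  assumes "s \<noteq> 0" "norm s < 1" "x \<noteq> 0"
  shows "theta s (inverse x) = - inverse x * theta s x"
proof -
  have "((\<lambda>k. - inverse x * ((-1) powi k * s powi (k * (k - 1)) * x powi k)) has_sum (- inverse x * theta s x)) UNIV"
    by (rule has_sum_cmult_right[OF theta_has_sum[OF assms]])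
  also have "?this \<longleftrightarrow> ((\<lambda>k. (-1) powi k * s powi (k * (k - 1)) * inverse x powi k) has_sum (- inverse x * theta s x)) UNIV"
  proof (rule has_sum_reindex_bij_witness[of _ "\<lambda>k. 1 - k" "\<lambda>k. 1 - k"])
    fix k :: int
    have "inverse x powi (1 - k) = inverse x * x powi k"
      using assms by (simp add: power_int_diff power_int_inverse field_simps)
    moreover have "(1 - k) * (1 - k - 1) = k * (k - 1)" by (simp add: algebra_simps)
    ultimately show "(-1) powi (1 - k) * s powi ((1 - k) * (1 - k - 1)) * inverse x powi (1 - k) =
      - inverse x * ((-1) powi k * s powi (k * (k - 1)) * x powi k)"
      by (simp add: power_int_minus_left)
  qed auto
  finally show ?thesis
    using has_sum_unique theta_has_sum[OF assms(1,2), of "inverse x"] assms(3) by fastforce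
qed

text \<open>The sign selects, for each \<open>M\<close>, the half of the \<open>n\<close>-line on which \<open>M (2 n + 1) \<ge> \<bar>M\<bar>\<close>; this is
  what makes the double series converge absolutely.\<close>
definition wcoeff :: "complex \<Rightarrow> int \<Rightarrow> int \<Rightarrow> complex" where
  "wcoeff q M n = (if M \<ge> 0 \<and> n \<ge> 0 then 1 else if M < 0 \<and> n < 0 then -1 else 0) *
     q powi (2 * n * (n + 1) + M * (2 * n + 1))"

lemma summable_on_gauss_shift:
  fixes q y :: complex
  assumes "q \<noteq> 0" "norm q < 1" "y \<noteq> 0"
  shows "(\<lambda>n. q powi (2 * n * (n + 1) + M * (2 * n + 1)) * y powi n) summable_on A"
proof -
  have "norm (q\<^sup>2) < 1" using assms by (simp add: norm_power power_less_one_iff)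
  then have "(\<lambda>n. q powi M * ((q\<^sup>2) powi (n * n) * (q powi (2 + 2 * M) * y) powi n)) summable_on UNIV"
    using assms by (intro summable_on_cmult_right summable_on_gauss) auto
  also have "(\<lambda>n. q powi M * ((q\<^sup>2) powi (n * n) * (q powi (2 + 2 * M) * y) powi n)) =
     (\<lambda>n. q powi (2 * n * (n + 1) + M * (2 * n + 1)) * y powi n)"
  proof
    fix n :: int
    have "q powi M * ((q\<^sup>2) powi (n * n) * (q powi (2 + 2 * M) * y) powi n) =
      (q powi M * (q powi (2 * (n * n)) * q powi ((2 + 2 * M) * n))) * y powi n"
      by (simp add: power_int_mult_distrib power_int_power mult_ac flip: power_int_mult)
    also have "q powi M * (q powi (2 * (n * n)) * q powi ((2 + 2 * M) * n)) = q powi (M + (2 * (n * n) + (2 + 2 * M) * n))"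
      using assms by (simp add: power_int_add)
    also have "M + (2 * (n * n) + (2 + 2 * M) * n) = 2 * n * (n + 1) + M * (2 * n + 1)"
      by (simp add: algebra_simps)
    finally show "q powi M * ((q\<^sup>2) powi (n * n) * (q powi (2 + 2 * M) * y) powi n) =
      q powi (2 * n * (n + 1) + M * (2 * n + 1)) * y powi n" .
  qed
  finally show ?thesis by (rule summable_on_subset) auto
qed

lemma summable_on_wcoeff:
  fixes q x y :: complex
  assumes q: "q \<noteq> 0" "norm q < 1" and x: "norm q < norm x" "norm x < 1 / norm q" and y: "y \<noteq> 0"
  shows "(\<lambda>(M,n). wcoeff q M n * x powi M * y powi n) summable_on UNIV"
proof (rule summable_on_norm_bound)
  have "(\<lambda>M::int. norm (norm q ^ nat \<bar>M\<bar> * norm x powi M)) summable_on UNIV"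
    using summable_on_two_sided_geometric[of "norm q" x] q x by (simp add: abs_mult)
  moreover have "(\<lambda>n. norm (q powi (2 * n * (n + 1) + 0 * (2 * n + 1)) * y powi n)) summable_on UNIV"
    using summable_on_gauss_shift[OF q y, of 0] by (simp only: summable_on_iff_abs_summable_on_complex)
  then have "(\<lambda>n. norm (norm q powi (2 * n * (n + 1)) * norm y powi n)) summable_on UNIV"
    by (simp add: norm_mult norm_power_int abs_mult)
  ultimately show "(\<lambda>(M,n). norm (norm q ^ nat \<bar>M\<bar> * norm x powi M * (norm q powi (2 * n * (n + 1)) * norm y powi n))) summable_on UNIV"
    using summable_on_norm_times by fastforce
  fix Mn :: "int \<times> int"
  obtain M n where Mn: "Mn = (M, n)" by (cases Mn)
  have "norm (wcoeff q M n) \<le> norm q ^ nat \<bar>M\<bar> * norm q powi (2 * n * (n + 1))"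
  proof (cases "(M \<ge> 0 \<and> n \<ge> 0) \<or> (M < 0 \<and> n < 0)")
    case True
    \<comment> \<open>The odd number 2n + 1 has absolute value at least 1, and on the sectors
      selected by \<open>wcoeff\<close> the product M (2n + 1) is nonnegative; this yields decay in
      M that is uniform in n.\<close>
    have "\<bar>M\<bar> * 1 \<le> \<bar>M\<bar> * \<bar>2 * n + 1\<bar>" by (rule mult_left_mono) presburger+
    also have "\<dots> = M * (2 * n + 1)" using True by (auto simp: abs_if algebra_simps)
    finally have "\<bar>M\<bar> + 2 * n * (n + 1) \<le> 2 * n * (n + 1) + M * (2 * n + 1)" by simp
    then have "norm q powi (2 * n * (n + 1) + M * (2 * n + 1)) \<le> norm q powi (\<bar>M\<bar> + 2 * n * (n + 1))"
      using q by (intro power_int_decreasing) auto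
    also have "\<dots> = norm q ^ nat \<bar>M\<bar> * norm q powi (2 * n * (n + 1))"
      using q by (subst power_int_add) (auto simp: power_int_def[of _ "\<bar>M\<bar>"])
    finally show ?thesis using True by (auto simp: wcoeff_def norm_power_int norm_mult)
  next
    case False
    then have "wcoeff q M n = 0" by (auto simp: wcoeff_def)
    then show ?thesis by simp
  qed
  then have "norm (wcoeff q M n) * (norm x powi M * norm y powi n) \<le>
     (norm q ^ nat \<bar>M\<bar> * norm q powi (2 * n * (n + 1))) * (norm x powi M * norm y powi n)"
    by (rule mult_right_mono) auto
  then show "norm (case Mn of (M,n) \<Rightarrow> wcoeff q M n * x powi M * y powi n) \<le> (case Mn of (M,n) \<Rightarrow>
    norm (norm q ^ nat \<bar>M\<bar> * norm x powi M * (norm q powi (2 * n * (n + 1)) * norm y powi n)))"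
    by (simp add: Mn norm_mult norm_power_int abs_mult mult_ac)
qed

text \<open>The exponent is invariant under n -> -1 - M - n, so for antisymmetric \<open>g\<close>
  the half-line n < 0 taken with sign -1 contributes the same as n >= 0. This makes the coefficients
  uniform in the sign of M.\<close>

lemma has_sum_wcoeff_antisymmetric:
  fixes g :: "int \<Rightarrow> complex"
  assumes summable: "(\<lambda>n. q powi (2 * n * (n + 1) + M * (2 * n + 1)) * g n) summable_on UNIV"
    and antisym: "\<And>n. g (- 1 - M - n) = - g n"
  shows "((\<lambda>n. wcoeff q M n * g n) has_sum
    (\<Sum>\<^sub>\<infinity>n\<in>{0..}. q powi (2 * n * (n + 1) + M * (2 * n + 1)) * g n)) UNIV"
proof -
  define f where "f = (\<lambda>n. q powi (2 * n * (n + 1) + M * (2 * n + 1)) * g n)"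
  have f: "f summable_on A" for A
    using summable unfolding f_def by (rule summable_on_subset) auto
  show ?thesis
  proof (cases "M \<ge> 0")
    case True
    have "(f has_sum infsum f {0..}) {0..}" by (rule has_sum_infsum[OF f])
    also have "?this \<longleftrightarrow> ((\<lambda>n. wcoeff q M n * g n) has_sum infsum f {0..}) UNIV"
      by (rule has_sum_cong_neutral) (use True in \<open>auto simp: wcoeff_def f_def\<close>)
    finally show ?thesis by (simp add: f_def)
  next
    case False
    have "infsum f {0..} = - infsum f {..<0}"
    proof (rule infsum_antisymmetric_half[OF f])
      fix n :: int
      have "2 * (-1 - M - n) * (-1 - M - n + 1) + M * (2 * (-1 - M - n) + 1) = 2 * n * (n + 1) + M * (2 * n + 1)"
        by (simp add: algebra_simps)
      then show "f (-1 - M - n) = - f n" unfolding f_def using antisym[of n] by simp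
    qed
    then have "((\<lambda>n. - f n) has_sum infsum f {0..}) {..<0}"
      using has_sum_uminusI[OF has_sum_infsum[OF f]] by metis
    also have "?this \<longleftrightarrow> ((\<lambda>n. wcoeff q M n * g n) has_sum infsum f {0..}) UNIV"
      by (rule has_sum_cong_neutral) (use False in \<open>auto simp: wcoeff_def f_def\<close>)
    finally show ?thesis by (simp add: f_def)
  qed
qed

text \<open>The coefficient of b^M in B. The geometric expansion uses powers M >= 0 for n >= 0 and M
  < 0 for n < 0, the sign pattern of \<open>wcoeff\<close>; the bracket is antisymmetric under n ->
  -1 - M - n, which reduces both cases to this one sum.\<close>

definition appell_coeff :: "complex \<Rightarrow> complex \<Rightarrow> int \<Rightarrow> complex" where
  "appell_coeff q a M = (\<Sum>\<^sub>\<infinity>n\<in>{0..}. q powi (2 * n * (n + 1) + M * (2 * n + 1)) * (a powi (- n) - a powi (n + 1 + M)))"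

lemma summable_on_appell_coeff:
  fixes q a :: complex
  assumes "q \<noteq> 0" "norm q < 1" "a \<noteq> 0"
  shows "(\<lambda>n. q powi (2 * n * (n + 1) + M * (2 * n + 1)) * (a powi (- n) - a powi (n + 1 + M))) summable_on A"
proof -
  have "(\<lambda>n. q powi (2 * n * (n + 1) + M * (2 * n + 1)) * inverse a powi n -
      q powi (2 * n * (n + 1) + M * (2 * n + 1)) * a powi n * a powi (1 + M)) summable_on A"
    using assms by (intro summable_on_diff summable_on_cmult_left summable_on_gauss_shift) auto
  then show ?thesis
    using assms by (simp add: algebra_simps power_int_add power_int_minus power_int_inverse)
qed

lemma appell_coeff_has_sum:
  fixes q a :: complex
  assumes "q \<noteq> 0" "norm q < 1" "a \<noteq> 0"
  shows "((\<lambda>n. q powi (2 * n * (n + 1) + M * (2 * n + 1)) * (a powi (- n) - a powi (n + 1 + M)))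
    has_sum appell_coeff q a M) {0..}"
  unfolding appell_coeff_def by (rule has_sum_infsum[OF summable_on_appell_coeff[OF assms]])

text \<open>With j = i + n the exponent becomes K + n(n + 1) + 2nK + i(i - 1), so n and i separate.
  The part with a^(-n) meets theta(1) = 0; the part with a^(n + 1 + K - j) = a^(1 + K - i) leaves
  theta at 1/a times a partial theta value.\<close>

lemma theta_appell_convolution:
  fixes q a :: complex
  assumes q: "q \<noteq> 0" "norm q < 1" and a: "a \<noteq> 0"
  shows "((\<lambda>j. (-1) powi j * q powi (j * j) * appell_coeff q a (K - j)) has_sum
    (theta q a * (ptheta q K * (q * a) powi K))) UNIV"
proof -
  define u where "u = (\<lambda>n. q powi K * ((-1) powi n * q powi (n * (n + 1) + 2 * n * K)))"
  have u: "(u has_sum (q powi K * ptheta q K)) {0..}"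
    unfolding u_def by (rule has_sum_cmult_right[OF ptheta_has_sum[OF q]])
  have u_sum: "(\<lambda>n. u n * inverse a powi n) summable_on {0..}"
  proof -
    have "(\<lambda>k::int. q powi K * ((-1) powi k * q powi (k * (k - 1)) * (q powi (2 + 2 * K) * inverse a) powi k)) summable_on UNIV"
      using q a by (intro summable_on_cmult_right summable_on_theta_terms) auto
    also have "(\<lambda>k::int. q powi K * ((-1) powi k * q powi (k * (k - 1)) * (q powi (2 + 2 * K) * inverse a) powi k)) = (\<lambda>n. u n * inverse a powi n)"
      using q by (auto simp: u_def power_int_mult_distrib algebra_simps simp flip: power_int_mult power_int_add)
    finally show ?thesis by (rule summable_on_subset) auto
  qed
  have "((\<lambda>(n,i). u n * inverse a powi n * ((-1) powi i * q powi (i * (i - 1)) * 1 powi i)) has_sum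
     (infsum (\<lambda>n. u n * inverse a powi n) {0..} * theta q 1)) ({0..} \<times> UNIV)"
    by (rule has_sum_times[OF has_sum_infsum[OF u_sum] theta_has_sum[OF q one_neq_zero]])
  moreover have "((\<lambda>(n,i). u n * a powi (1 + K) * ((-1) powi i * q powi (i * (i - 1)) * inverse a powi i)) has_sum
     (q powi K * ptheta q K * a powi (1 + K) * theta q (inverse a))) ({0..} \<times> UNIV)"
    by (rule has_sum_times[OF has_sum_cmult_left[OF u] theta_has_sum[OF q]]) (use a in auto)
  ultimately have "((\<lambda>x. (case x of (n,i) \<Rightarrow> u n * inverse a powi n * ((-1) powi i * q powi (i * (i - 1)) * 1 powi i)) -
      (case x of (n,i) \<Rightarrow> u n * a powi (1 + K) * ((-1) powi i * q powi (i * (i - 1)) * inverse a powi i))) has_sum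
     (0 - q powi K * ptheta q K * a powi (1 + K) * theta q (inverse a))) ({0..} \<times> UNIV)"
    unfolding theta_one[OF q] mult_zero_right by (rule has_sum_diff)
  also have "0 - q powi K * ptheta q K * a powi (1 + K) * theta q (inverse a) = theta q a * (ptheta q K * (q * a) powi K)"
    using a by (simp add: theta_inverse[OF q a] power_int_add power_int_mult_distrib)
  also have "((\<lambda>x. (case x of (n,i) \<Rightarrow> u n * inverse a powi n * ((-1) powi i * q powi (i * (i - 1)) * 1 powi i)) -
      (case x of (n,i) \<Rightarrow> u n * a powi (1 + K) * ((-1) powi i * q powi (i * (i - 1)) * inverse a powi i))) has_sum
     (theta q a * (ptheta q K * (q * a) powi K))) ({0..} \<times> UNIV) \<longleftrightarrow>
    ((\<lambda>(j,n). (-1) powi j * q powi (j * j) * (q powi (2 * n * (n + 1) + (K - j) * (2 * n + 1)) *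
      (a powi (- n) - a powi (n + 1 + (K - j))))) has_sum (theta q a * (ptheta q K * (q * a) powi K))) (UNIV \<times> {0..})"
  proof (rule has_sum_reindex_bij_witness[of _ "\<lambda>(j,n). (n, j - n)" "\<lambda>(n,i). (i + n, n)"])
    fix x :: "int \<times> int"
    obtain n i where x: "x = (n, i)" by (cases x)
    have 1: "(i + n) * (i + n) + (2 * n * (n + 1) + (K - (i + n)) * (2 * n + 1)) = K + (n * (n + 1) + 2 * n * K) + i * (i - 1)"
      by (simp add: algebra_simps)
    have "(-1) powi (i + n) * q powi ((i + n) * (i + n)) * q powi (2 * n * (n + 1) + (K - (i + n)) * (2 * n + 1))
       = ((-1) powi i * (-1) powi n) * (q powi ((i + n) * (i + n)) * q powi (2 * n * (n + 1) + (K - (i + n)) * (2 * n + 1)))"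
      by (simp add: power_int_add mult_ac)
    also have "q powi ((i + n) * (i + n)) * q powi (2 * n * (n + 1) + (K - (i + n)) * (2 * n + 1)) = 
       q powi K * q powi (n * (n + 1) + 2 * n * K) * q powi (i * (i - 1))"
      using q(1) 1 by (metis power_int_add)
    finally have 2: "(-1) powi (i + n) * q powi ((i + n) * (i + n)) * q powi (2 * n * (n + 1) + (K - (i + n)) * (2 * n + 1))
       = u n * ((-1) powi i * q powi (i * (i - 1)))" by (simp add: u_def mult_ac)
    have 3: "n + 1 + (K - (i + n)) = 1 + K - i" by simp
    have 4: "a powi (1 + K - i) = a powi (1 + K) * inverse a powi i"
      using a power_int_diff[of a "1 + K" i] by (simp add: power_int_inverse divide_inverse)
    have "(-1) powi (i + n) * q powi ((i + n) * (i + n)) * (q powi (2 * n * (n + 1) + (K - (i + n)) * (2 * n + 1)) *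
      (a powi (- n) - a powi (n + 1 + (K - (i + n))))) = u n * ((-1) powi i * q powi (i * (i - 1))) * (inverse a powi n - a powi (1 + K) * inverse a powi i)"
      unfolding 2[symmetric] 3 4 by (simp add: power_int_minus power_int_inverse)
    then show "(case case x of (n,i) \<Rightarrow> (i + n, n) of (j,n) \<Rightarrow> (-1) powi j * q powi (j * j) * (q powi (2 * n * (n + 1) + (K - j) * (2 * n + 1)) *
      (a powi (- n) - a powi (n + 1 + (K - j))))) =
      (case x of (n,i) \<Rightarrow> u n * inverse a powi n * ((-1) powi i * q powi (i * (i - 1)) * 1 powi i)) -
      (case x of (n,i) \<Rightarrow> u n * a powi (1 + K) * ((-1) powi i * q powi (i * (i - 1)) * inverse a powi i))"
      by (simp add: x algebra_simps)
  qed auto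
  finally show ?thesis
    by (rule has_sum_SigmaD) (use has_sum_cmult_right[OF appell_coeff_has_sum[OF q a]] in simp)
qed

text \<open>Only theta(q b) is multiplied in. The coefficients that remain are, up to the factor
  theta(a), those of 1/theta at q a b, and the annulus assumed for a b is where that expansion is
  valid.\<close>

lemma appell_laurent_times_theta:
  fixes q a b :: complex
  assumes q: "q \<noteq> 0" "norm q < 1" and a: "a \<noteq> 0" and b: "b \<noteq> 0"
    and B: "((\<lambda>M. appell_coeff q a M * b powi M) has_sum B) UNIV"
    and ab: "norm q < norm (a * b)" "norm (a * b) < 1 / norm q"
  shows "B * theta q (q * b) * theta q (q * (a * b)) = theta q a * euler (q\<^sup>2) ^ 3"
proof -
  have ab': "norm q ^ 2 < norm (q * (a * b))" "norm (q * (a * b)) < 1"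
    using q ab by (auto simp: norm_mult power2_eq_square field_simps)
  have qb: "((\<lambda>j. (-1) powi j * q powi (j * j) * b powi j) has_sum theta q (q * b)) UNIV"
  proof -
    have "(\<lambda>j. (-1) powi j * q powi (j * (j - 1)) * (q * b) powi j) = (\<lambda>j. (-1) powi j * q powi (j * j) * b powi j)"
      using q by (auto simp: power_int_mult_distrib algebra_simps simp flip: power_int_add)
    then show ?thesis using theta_has_sum[OF q, of "q * b"] q b by simp
  qed
  have "((\<lambda>(M,j). appell_coeff q a M * b powi M * ((-1) powi j * q powi (j * j) * b powi j)) has_sum
     (B * theta q (q * b))) (UNIV \<times> UNIV)"
    by (rule has_sum_times[OF B qb])
  also have "?this \<longleftrightarrow> ((\<lambda>(K,j). b powi K * ((-1) powi j * q powi (j * j) * appell_coeff q a (K - j))) has_sum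
     (B * theta q (q * b))) (UNIV \<times> UNIV)"
    by (rule has_sum_reindex_bij_witness[of _ "\<lambda>(K,j). (K - j, j)" "\<lambda>(M,j). (M + j, j)"])
       (use b in \<open>auto simp: power_int_add mult_ac\<close>)
  finally have "((\<lambda>K. b powi K * (theta q a * (ptheta q K * (q * a) powi K))) has_sum (B * theta q (q * b))) UNIV"
    by (rule has_sum_SigmaD) (use has_sum_cmult_right[OF theta_appell_convolution[OF q a]] in simp)
  moreover have "(\<lambda>K. b powi K * (theta q a * (ptheta q K * (q * a) powi K))) =
      (\<lambda>K. theta q a * (ptheta q K * (q * (a * b)) powi K))"
    by (auto simp: power_int_mult_distrib mult_ac)
  moreover have "((\<lambda>K. theta q a * (ptheta q K * (q * (a * b)) powi K)) has_sum
     (theta q a * (\<Sum>\<^sub>\<infinity>K. ptheta q K * (q * (a * b)) powi K))) UNIV"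
    by (intro has_sum_cmult_right has_sum_infsum summable_on_ptheta_laurent q ab')
  ultimately have "B * theta q (q * b) = theta q a * (\<Sum>\<^sub>\<infinity>K. ptheta q K * (q * (a * b)) powi K)"
    using has_sum_unique by metis
  then show ?thesis
    using ptheta_laurent_times_theta[OF q(1) ab'] by simp
qed

text \<open>Convolution of the expansion of 1 / \<open>theta s a\<close> with the two powers of a in
  \<open>appell_coeff\<close>: n + M1 and M1 - n - 1 - M2 are what is left of M1 after removing -n
  and n + 1 + M2.\<close>

definition quotient_coeff :: "complex \<Rightarrow> int \<Rightarrow> int \<Rightarrow> complex" where
  "quotient_coeff s M1 M2 = (\<Sum>\<^sub>\<infinity>n\<in>{0..}. (s\<^sup>2) powi (2 * n * (n + 1) + M2 * (2 * n + 1)) *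
     (ptheta s (n + M1) - ptheta s (M1 - n - 1 - M2)))"

lemma summable_on_gauss_ptheta:
  fixes s :: complex
  assumes s: "s \<noteq> 0" "norm s < 1" and c: "c = 1 \<or> c = - 1"
  shows "(\<lambda>n. (s\<^sup>2) powi (2 * n * (n + 1) + M * (2 * n + 1)) * ptheta s (c * n + m)) summable_on A"
proof -
  define q where "q = s\<^sup>2"
  have q: "q \<noteq> 0" "norm q < 1" using s by (auto simp: q_def norm_power power_less_one_iff)
  obtain K where K: "K > 0" "\<And>j. j \<ge> 0 \<Longrightarrow> norm (ptheta s j) \<le> K"
    "\<And>j. j < 0 \<Longrightarrow> norm (ptheta s j) \<le> K * norm s powi (- 2 * j)"
    using ptheta_bounded[OF s] by metis
  \<comment> \<open>A single bound for all j, each summand of which keeps the sum over n Gaussian.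
    For j >= 0 the second summand is wasteful, but harmless against the quadratic exponent.\<close>
  have bound: "norm (ptheta s j) \<le> K * (1 + norm (s powi (- 2 * j)))" for j
  proof (cases "j \<ge> 0")
    case True
    then have "norm (ptheta s j) \<le> K * 1" using K(2) by simp
    also have "\<dots> \<le> K * (1 + norm (s powi (- 2 * j)))" using K(1) by (intro mult_left_mono) auto
    finally show ?thesis .
  next
    case False
    then have "norm (ptheta s j) \<le> K * norm (s powi (- 2 * j))" using K(3)[of j] by (simp only: norm_power_int not_le)
    also have "\<dots> \<le> K * (1 + norm (s powi (- 2 * j)))" using K(1) by (intro mult_left_mono) auto
    finally show ?thesis .
  qed
  define f where "f = (\<lambda>n. q powi (2 * n * (n + 1) + M * (2 * n + 1)))"
  have 1: "(\<lambda>n. norm (f n)) summable_on A"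
    using summable_on_gauss_shift[OF q, of 1 M A] by (simp add: f_def summable_on_iff_abs_summable_on_complex)
  have "(\<lambda>n. f n * (s powi (- 2 * c)) powi n * s powi (- 2 * m)) summable_on A"
    unfolding f_def using s by (intro summable_on_cmult_left summable_on_gauss_shift q) auto
  moreover have "f n * (s powi (- 2 * c)) powi n * s powi (- 2 * m) = f n * s powi (- 2 * (c * n + m))" for n
    using s by (simp add: algebra_simps flip: power_int_mult power_int_add)
  ultimately have 2: "(\<lambda>n. norm (f n * s powi (- 2 * (c * n + m)))) summable_on A"
    by (simp only: summable_on_iff_abs_summable_on_complex)
  have "(\<lambda>n. K * (norm (f n) + norm (f n * s powi (- 2 * (c * n + m))))) summable_on A"
    by (intro summable_on_cmult_right summable_on_add 1 2)
  then have "(\<lambda>n. f n * ptheta s (c * n + m)) summable_on A"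
  proof (rule summable_on_norm_bound)
    fix n
    show "norm (f n * ptheta s (c * n + m)) \<le> K * (norm (f n) + norm (f n * s powi (- 2 * (c * n + m))))"
      using mult_left_mono[OF bound[of "c * n + m"], of "norm (f n)"] by (simp add: norm_mult algebra_simps)
  qed
  then show ?thesis by (simp add: f_def q_def)
qed

lemma summable_on_quotient_coeff:
  fixes s :: complex
  assumes s: "s \<noteq> 0" "norm s < 1"
  shows "(\<lambda>n. (s\<^sup>2) powi (2 * n * (n + 1) + M2 * (2 * n + 1)) *
     (ptheta s (n + M1) - ptheta s (M1 - n - 1 - M2))) summable_on A"
proof -
  have eq: "M1 - n - 1 - M2 = - 1 * n + (M1 - 1 - M2)" for n by simp
  show ?thesis
    unfolding eq using summable_on_diff[OF summable_on_gauss_ptheta[OF s, of 1 M2 M1 A] summable_on_gauss_ptheta[OF s, of "- 1" M2 "M1 - 1 - M2" A]]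
    by (simp add: right_diff_distrib)
qed

lemma quotient_coeff_has_sum:
  fixes s a b :: complex
  assumes s: "s \<noteq> 0" "norm s < 1"
    and a: "norm s ^ 2 < norm a" "norm a < 1" and b: "norm s ^ 2 < norm b" "norm b < 1"
    and ab: "norm s ^ 2 < norm (a * b)"
  shows "((\<lambda>(M1,M2). quotient_coeff s M1 M2 * a powi M1 * b powi M2) has_sum
     (euler (s\<^sup>2) ^ 3 * euler (s^4) ^ 3 * theta (s\<^sup>2) a /
       (theta s a * theta (s\<^sup>2) (s\<^sup>2 * b) * theta (s\<^sup>2) (s\<^sup>2 * (a * b))))) UNIV"
proof -
  define q where "q = s\<^sup>2"
  have q: "q \<noteq> 0" "norm q < 1" using s by (auto simp: q_def norm_power power_less_one_iff)
  have nq: "norm s ^ 2 = norm q" by (simp add: q_def norm_power)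
  have s4: "s ^ 4 = q\<^sup>2" by (simp add: q_def flip: power_mult)
  have q1: "1 < 1 / norm q" using q by (simp add: field_simps)
  have nz: "a \<noteq> 0" "b \<noteq> 0" using a b by auto
  have ab1: "norm (a * b) < 1" using a b nz mult_strict_mono[of "norm a" 1 "norm b" 1] by (simp add: norm_mult)
  define AA where "AA = (\<Sum>\<^sub>\<infinity>j. ptheta s j * a powi j)"
  have AA: "((\<lambda>j. ptheta s j * a powi j) has_sum AA) UNIV"
    unfolding AA_def by (rule has_sum_infsum[OF summable_on_ptheta_laurent[OF s(1) a]])
  \<comment> \<open>The bracket in \<open>appell_coeff\<close> is split because its halves are
    series in different variables, b and a b, each absolutely convergent on its own annulus. They
    are recombined below, since only the difference is antisymmetric in n.\<close>
  define f1 where "f1 = (\<lambda>(M,n). wcoeff q M n * b powi M * inverse a powi n)"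
  define f2 where "f2 = (\<lambda>(M,n). a * (wcoeff q M n * (a * b) powi M * a powi n))"
  have f1: "f1 summable_on UNIV"
    unfolding f1_def using b nz q1 by (intro summable_on_wcoeff[OF q]) (auto simp: nq)
  have "(\<lambda>x. a * (case x of (M,n) \<Rightarrow> wcoeff q M n * (a * b) powi M * a powi n)) summable_on UNIV"
    using ab ab1 nz q1 by (intro summable_on_cmult_right summable_on_wcoeff[OF q]) (auto simp: nq)
  then have f2: "f2 summable_on UNIV" by (simp add: f2_def case_prod_unfold)
  define B where "B = infsum f1 UNIV - infsum f2 UNIV"
  have "((\<lambda>x. f1 x - f2 x) has_sum B) (UNIV \<times> UNIV)"
    unfolding B_def by (intro has_sum_diff) (use f1 f2 in auto)
  then have B: "((\<lambda>M. appell_coeff q a M * b powi M) has_sum B) UNIV"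
  proof (rule has_sum_SigmaD)
    fix M :: int
    have "((\<lambda>n. wcoeff q M n * (a powi (- n) - a powi (n + 1 + M))) has_sum appell_coeff q a M) UNIV"
      unfolding appell_coeff_def
      by (rule has_sum_wcoeff_antisymmetric[OF summable_on_appell_coeff[OF q nz(1)]]) (simp add: algebra_simps)
    from has_sum_cmult_left[OF this, of "b powi M"]
    show "((\<lambda>n. f1 (M, n) - f2 (M, n)) has_sum (appell_coeff q a M * b powi M)) UNIV"
      using nz by (simp add: f1_def f2_def algebra_simps power_int_add power_int_mult_distrib power_int_minus power_int_inverse)
  qed
  have Bval: "B * theta q (q * b) * theta q (q * (a * b)) = theta q a * euler (q\<^sup>2) ^ 3"
    using ab ab1 nz q1 by (intro appell_laurent_times_theta[OF q nz B]) (auto simp: nq)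
  have Aval: "AA * theta s a = euler q ^ 3"
    unfolding AA_def q_def by (rule ptheta_laurent_times_theta[OF s(1) a])
  have tnz: "theta s a \<noteq> 0" by (rule theta_nonzero[OF s(1) a])
  have tnz2: "theta q (q * x) \<noteq> 0" if "norm s ^ 2 < norm x" "norm x < 1" for x
    using that q(1) by (intro theta_times_nome_nonzero) (auto simp: nq)
  have total: "AA * B = euler q ^ 3 * euler (q\<^sup>2) ^ 3 * theta q a / (theta s a * theta q (q * b) * theta q (q * (a * b)))"
  proof -
    have "AA = euler q ^ 3 / theta s a" using Aval tnz by (simp add: field_simps)
    moreover have "B = theta q a * euler (q\<^sup>2) ^ 3 / (theta q (q * b) * theta q (q * (a * b)))"
      using Bval tnz2[OF b] tnz2[OF ab ab1] by (simp add: field_simps)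
    ultimately show ?thesis by (simp add: mult_ac)
  qed
  have 1: "((\<lambda>((M1,M2),n). wcoeff q M2 n * ptheta s (n + M1) * (a powi M1 * b powi M2)) has_sum (AA * infsum f1 UNIV)) (UNIV \<times> UNIV)"
  proof -
    have "((\<lambda>(j,x). ptheta s j * a powi j * f1 x) has_sum (AA * infsum f1 UNIV)) (UNIV \<times> UNIV)"
      by (rule has_sum_times[OF AA has_sum_infsum[OF f1]])
    also have "?this \<longleftrightarrow> ?thesis"
      by (rule has_sum_reindex_bij_witness[of _ "\<lambda>((M1,M2),n). (n + M1, (M2, n))" "\<lambda>(j,(M,n)). ((j - n, M), n)"])
         (use nz in \<open>auto simp: f1_def power_int_diff power_int_inverse field_simps\<close>)
    finally show ?thesis .
  qed
  have 2: "((\<lambda>((M1,M2),n). wcoeff q M2 n * ptheta s (M1 - n - 1 - M2) * (a powi M1 * b powi M2)) has_sum (AA * infsum f2 UNIV)) (UNIV \<times> UNIV)"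
  proof -
    have "((\<lambda>(j,x). ptheta s j * a powi j * f2 x) has_sum (AA * infsum f2 UNIV)) (UNIV \<times> UNIV)"
      by (rule has_sum_times[OF AA has_sum_infsum[OF f2]])
    also have "?this \<longleftrightarrow> ?thesis"
      by (rule has_sum_reindex_bij_witness[of _ "\<lambda>((M1,M2),n). (M1 - n - 1 - M2, (M2, n))" "\<lambda>(j,(M,n)). ((j + n + 1 + M, M), n)"])
         (use nz in \<open>auto simp: f2_def power_int_add power_int_mult_distrib mult_ac\<close>)
    finally show ?thesis .
  qed
  have "((\<lambda>x. (case x of ((M1,M2),n) \<Rightarrow> wcoeff q M2 n * ptheta s (n + M1) * (a powi M1 * b powi M2)) -
     (case x of ((M1,M2),n) \<Rightarrow> wcoeff q M2 n * ptheta s (M1 - n - 1 - M2) * (a powi M1 * b powi M2))) has_sum (AA * B)) (UNIV \<times> UNIV)"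
    using has_sum_diff[OF 1 2] by (simp add: B_def right_diff_distrib case_prod_unfold)
  then have "((\<lambda>(M1,M2). quotient_coeff s M1 M2 * a powi M1 * b powi M2) has_sum (AA * B)) UNIV"
  proof (rule has_sum_SigmaD)
    fix M :: "int \<times> int"
    obtain M1 M2 where M: "M = (M1, M2)" by (cases M)
    have "((\<lambda>n. wcoeff q M2 n * (ptheta s (n + M1) - ptheta s (M1 - n - 1 - M2))) has_sum quotient_coeff s M1 M2) UNIV"
      unfolding quotient_coeff_def q_def
      by (rule has_sum_wcoeff_antisymmetric[OF summable_on_quotient_coeff[OF s]]) (simp add: algebra_simps)
    from has_sum_cmult_left[OF this, of "a powi M1 * b powi M2"]
    show "((\<lambda>n. (case (M, n) of ((M1,M2),n) \<Rightarrow> wcoeff q M2 n * ptheta s (n + M1) * (a powi M1 * b powi M2)) -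
     (case (M, n) of ((M1,M2),n) \<Rightarrow> wcoeff q M2 n * ptheta s (M1 - n - 1 - M2) * (a powi M1 * b powi M2))) has_sum
       (case M of (M1,M2) \<Rightarrow> quotient_coeff s M1 M2 * a powi M1 * b powi M2)) UNIV"
      by (simp add: M algebra_simps)
  qed
  then show ?thesis
    unfolding total s4 by (simp add: q_def)
qed

section \<open>Uniqueness of Laurent coefficients\<close>

lemma has_sum_sum_lessThan:
  fixes f :: "nat \<Rightarrow> 'a \<Rightarrow> complex"
  assumes "\<And>u. (f u has_sum S u) A"
  shows "((\<lambda>k. \<Sum>u<N. f u k) has_sum (\<Sum>u<N. S u)) A"
  by (induction N) (auto intro: has_sum_add assms)

lemma sum_roots_of_unity_eq_0:
  fixes m :: int
  assumes "m \<noteq> 0" "\<bar>m\<bar> < int N"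
  shows "(\<Sum>u<N. cis (2 * pi / real N) powi (int u * m)) = 0"
proof -
  have N: "N > 0" using assms by linarith
  define w where "w = cis (2 * pi / real N) powi m"
  have w1: "w \<noteq> 1"
  proof
    assume "w = 1"
    then have "cis (of_int m * (2 * pi / real N)) = 1"
      by (simp only: w_def cis_power_int)
    then have "exp (\<i> * complex_of_real (of_int m * (2 * pi / real N))) = 1"
      by (simp only: cis_conv_exp)
    then obtain n :: int where "of_int m * (2 * pi / real N) = of_int (2 * n) * pi"
      by (auto simp: exp_eq_1)
    then have "real_of_int m = of_int n * real N"
      using N by (simp add: field_simps)
    then have "m = n * int N" by (metis of_int_eq_iff of_int_mult of_int_of_nat_eq)
    with assms show False
      by (metis abs_mult abs_of_nat dvd_imp_le_int dvd_triv_right linorder_not_le)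
  qed
  have "w ^ N = cis (of_int m * (2 * pi / real N) * real N)"
    unfolding w_def power_int_power' by (simp only: cis_power_int of_int_mult of_int_of_nat_eq mult_ac)
  also have "of_int m * (2 * pi / real N) * real N = 2 * pi * of_int m"
    using N by simp
  also have "cis (2 * pi * of_int m) = 1"
    by (rule cis_multiple_2pi) auto
  finally have wN: "w ^ N = 1" .
  have "(\<Sum>u<N. cis (2 * pi / real N) powi (int u * m)) = (\<Sum>u<N. w ^ u)"
    unfolding w_def by (simp add: power_int_power' mult_ac)
  also have "\<dots> = (w ^ N - 1) / (w - 1)" by (rule geometric_sum[OF w1])
  finally show ?thesis by (simp add: wN)
qed

text \<open>Averaging over \<open>N\<close>-th roots of unity with \<open>N\<close> large isolates one coefficient up to a small tail.\<close>
lemma laurent_coeff_unique: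
  fixes c :: "int \<Rightarrow> complex"
  assumes "\<rho> > 0" and sum0: "\<And>x. norm x = \<rho> \<Longrightarrow> ((\<lambda>k. c k * x powi k) has_sum 0) UNIV"
  shows "c k0 = 0"
proof -
  define d where "d = (\<lambda>k. c k * complex_of_real \<rho> powi k)"
  have d: "d summable_on UNIV"
    using sum0[of "complex_of_real \<rho>"] assms(1) by (auto simp: d_def summable_on_def)
  then have dn: "(\<lambda>k. norm (d k)) summable_on UNIV"
    by (simp only: summable_on_iff_abs_summable_on_complex)
  have "norm (d k0) \<le> \<epsilon>" if "\<epsilon> > 0" for \<epsilon> :: real
  proof -
    obtain F where F: "finite F" "dist (\<Sum>k\<in>F. norm (d k)) (\<Sum>\<^sub>\<infinity>k. norm (d k)) \<le> \<epsilon>"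
      using infsum_finite_approximation[OF dn \<open>\<epsilon> > 0\<close>] by blast
    define S where "S = insert k0 F"
    have S: "finite S" "k0 \<in> S" using F by (auto simp: S_def)
    have tail: "((\<lambda>k. norm (d k)) has_sum ((\<Sum>\<^sub>\<infinity>k. norm (d k)) - (\<Sum>k\<in>S. norm (d k)))) (UNIV - S)"
      by (rule has_sum_Diff[OF has_sum_infsum[OF dn] has_sum_finite]) (use S in auto)
    have "(\<Sum>k\<in>F. norm (d k)) \<le> (\<Sum>k\<in>S. norm (d k))"
      by (rule sum_mono2) (use F in \<open>auto simp: S_def\<close>)
    then have small: "(\<Sum>\<^sub>\<infinity>k. norm (d k)) - (\<Sum>k\<in>S. norm (d k)) \<le> \<epsilon>"
      using F(2) by (auto simp: dist_real_def)
    \<comment> \<open>N exceeds every \<bar>k - k0\<bar> on \<open>S\<close>, so no k in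
      \<open>S\<close> other than k0 is congruent to k0 modulo N.\<close>
    obtain N where N: "\<And>k. k \<in> S \<Longrightarrow> \<bar>k - k0\<bar> < int N" "N > 0"
    proof -
      define N where "N = Suc (nat (\<Sum>k\<in>S. \<bar>k - k0\<bar>))"
      have "\<bar>k - k0\<bar> < int N" if "k \<in> S" for k
        using member_le_sum[of k S "\<lambda>k. \<bar>k - k0\<bar>"] S that by (simp add: N_def)
      then show ?thesis by (rule that) (simp_all add: N_def)
    qed
    define \<omega> where "\<omega> = cis (2 * pi / real N)"
    define w where "w = (\<lambda>k. (\<Sum>u<N. \<omega> powi (int u * (k - k0))) / of_nat N)"
    have \<omega>: "\<omega> \<noteq> 0" "norm \<omega> = 1" by (auto simp: \<omega>_def)
    have w: "w k0 = 1" "\<And>k. k \<in> S \<Longrightarrow> k \<noteq> k0 \<Longrightarrow> w k = 0"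
      using N(2) sum_roots_of_unity_eq_0[OF _ N(1), folded \<omega>_def] by (auto simp: w_def)
    have wle: "norm (w k) \<le> 1" for k
    proof -
      have "norm (\<Sum>u<N. \<omega> powi (int u * (k - k0))) \<le> (\<Sum>u<N. 1)"
        by (rule sum_norm_le) (simp add: norm_power_int \<omega>)
      then show ?thesis using N(2) by (simp add: w_def norm_divide)
    qed
    have "((\<lambda>k. \<Sum>u<N. \<omega> powi (- int u * k0) * (c k * (complex_of_real \<rho> * \<omega> powi int u) powi k)) has_sum (\<Sum>u<N. \<omega> powi (- int u * k0) * 0)) UNIV"
      by (intro has_sum_sum_lessThan has_sum_cmult_right sum0) (use assms(1) in \<open>simp add: norm_mult norm_power \<omega>\<close>)
    also have "(\<lambda>k. \<Sum>u<N. \<omega> powi (- int u * k0) * (c k * (complex_of_real \<rho> * \<omega> powi int u) powi k)) = (\<lambda>k. of_nat N * (w k * d k))"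
    proof
      fix k
      have "\<omega> powi (- int u * k0) * (c k * (complex_of_real \<rho> * \<omega> powi int u) powi k) = \<omega> powi (int u * (k - k0)) * d k" for u
      proof -
        have "\<omega> powi (- int u * k0) * \<omega> powi (int u * k) = \<omega> powi (int u * (k - k0))"
          using \<omega>(1) by (simp add: algebra_simps flip: power_int_add)
        then have "c k * complex_of_real \<rho> powi k * (\<omega> powi (- int u * k0) * \<omega> powi (int u * k)) = d k * \<omega> powi (int u * (k - k0))"
          by (simp add: d_def)
        moreover have "(complex_of_real \<rho> * \<omega> powi int u) powi k = complex_of_real \<rho> powi k * \<omega> powi (int u * k)"
          by (simp only: power_int_mult_distrib power_int_mult)
        ultimately show ?thesis by (simp only: mult_ac)
      qed
      then show "(\<Sum>u<N. \<omega> powi (- int u * k0) * (c k * (complex_of_real \<rho> * \<omega> powi int u) powi k)) = of_nat N * (w k * d k)"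
        using N(2) by (simp add: w_def sum_distrib_right[symmetric])
    qed
    finally have "((\<lambda>k. inverse (of_nat N) * (of_nat N * (w k * d k))) has_sum (inverse (of_nat N) * 0)) UNIV"
      by (intro has_sum_cmult_right) simp
    then have "((\<lambda>k. w k * d k) has_sum 0) UNIV"
      using N(2) by (simp add: mult.assoc[symmetric])
    moreover have "((\<lambda>k. w k * d k) has_sum d k0) S"
    proof (rule has_sum_finite_neutralI[of "{k0}"])
      show "d k0 = (\<Sum>k\<in>{k0}. w k * d k)" using w(1) by simp
    qed (use S w(2) in auto)
    ultimately have "((\<lambda>k. w k * d k) has_sum (0 - d k0)) (UNIV - S)"
      by (rule has_sum_Diff) auto
    then have "norm (0 - d k0) \<le> (\<Sum>\<^sub>\<infinity>k. norm (d k)) - (\<Sum>k\<in>S. norm (d k))"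
      by (rule norm_infsum_le[OF _ tail]) (use wle in \<open>auto simp: norm_mult mult_left_le_one_le\<close>)
    with small show ?thesis by simp
  qed
  then have "norm (d k0) \<le> 0"
    using field_le_epsilon[of "norm (d k0)" 0] by simp
  then show ?thesis using assms(1) by (simp add: d_def)
qed

text \<open>The definite descriptions in \<open>lpoly_coeff\<close> and
  \<open>region_laurent_coeff\<close> rest on this uniqueness. One torus suffices, so it can be
  placed away from excluded points or inside the region. The one-variable lemma is applied in a
  first and then in b.\<close>

lemma laurent_coeff_unique2:
  fixes c :: "int \<times> int \<Rightarrow> complex"
  assumes "\<rho> > 0" and sum0: "\<And>a b. norm a = \<rho> \<Longrightarrow> norm b = \<rho> \<Longrightarrow>
    ((\<lambda>m. c m * a powi fst m * b powi snd m) has_sum 0) UNIV"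
  shows "c m = 0"
proof -
  have "((\<lambda>m2. c (m1, m2) * b powi m2) has_sum 0) UNIV" if b: "norm b = \<rho>" for m1 b
  proof -
    have summable: "(\<lambda>m2. c (m1, m2) * b powi m2) summable_on UNIV" for m1
    proof -
      have "(\<lambda>(m1,m2). c (m1, m2) * complex_of_real \<rho> powi m1 * b powi m2) summable_on UNIV \<times> UNIV"
        using has_sum_imp_summable[OF sum0[of "complex_of_real \<rho>" b]] b assms(1) by (simp add: case_prod_unfold)
      from summable_on_SigmaD1[OF this, of m1]
      have "(\<lambda>m2. inverse (complex_of_real \<rho> powi m1) * (c (m1, m2) * complex_of_real \<rho> powi m1 * b powi m2)) summable_on UNIV"
        by (intro summable_on_cmult_right) simp
      then show ?thesis using assms(1) by (simp add: field_simps)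
    qed
    have "(\<Sum>\<^sub>\<infinity>m2. c (m1, m2) * b powi m2) = 0" for m1
    proof (rule laurent_coeff_unique[OF assms(1)])
      fix a :: complex assume a: "norm a = \<rho>"
      have "((\<lambda>m. c m * a powi fst m * b powi snd m) has_sum 0) (UNIV \<times> UNIV)"
        using sum0[OF a b] by simp
      then show "((\<lambda>m1. (\<Sum>\<^sub>\<infinity>m2. c (m1, m2) * b powi m2) * a powi m1) has_sum 0) UNIV"
      proof (rule has_sum_SigmaD)
        show "((\<lambda>y. c (x, y) * a powi fst (x, y) * b powi snd (x, y)) has_sum ((\<Sum>\<^sub>\<infinity>m2. c (x, m2) * b powi m2) * a powi x)) UNIV" for x
          using has_sum_cmult_left[OF has_sum_infsum[OF summable[of x]], of "a powi x"] by (simp add: mult_ac)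
      qed
    qed
    then show ?thesis using has_sum_infsum[OF summable] by metis
  qed
  then have "c (fst m, snd m) = 0"
    by (rule laurent_coeff_unique[OF assms(1)])
  then show ?thesis by simp
qed

section \<open>Weight multiplicities\<close>

text \<open>The number of ways to write \<open>(X - 1) \<alpha>\<^sub>1 + (Y - 1) \<alpha>\<^sub>2\<close> as a sum of positive roots of
  \<open>sl\<^sub>3\<close>; Kostant's formula then gives the weight multiplicities \<open>weyl_coeff\<close>.\<close>
definition minpos :: "int \<Rightarrow> int \<Rightarrow> int" where
  "minpos X Y = max 0 (min X Y)"

definition weyl_coeff :: "int \<Rightarrow> int \<Rightarrow> int \<times> int \<Rightarrow> int" where
  "weyl_coeff n1 n2 r = minpos (n1 - fst r) (n2 - snd r) - minpos (n2 - n1 - fst r) (n2 - snd r)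
     - minpos (n1 - fst r) (n1 - n2 - snd r) + minpos (- n2 - fst r) (n1 - n2 - snd r)
     + minpos (n2 - n1 - fst r) (- n1 - snd r) - minpos (- n2 - fst r) (- n1 - snd r)"

text \<open>The six shifts are those of the Weyl denominator (1 - A)(1 - B)(1 - A B) = 1 - A - B +
  A^2 B + A B^2 - A^2 B^2, where the terms A B cancel. \<open>minpos\<close> is its inverse under
  convolution, with the unit placed at (1, 1).\<close>

lemma minpos_difference:
  "minpos X Y - minpos (X - 1) Y - minpos X (Y - 1) + minpos (X - 2) (Y - 1) + minpos (X - 1) (Y - 2)
    - minpos (X - 2) (Y - 2) = (if X = 1 \<and> Y = 1 then 1 else 0)"
  by (auto simp: minpos_def max_def min_def)

lemma minpos_fst_nonneg: "X \<ge> 0 \<Longrightarrow> minpos X Y = max 0 Y - max 0 (Y - X)"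
  by (auto simp: minpos_def max_def min_def)

lemma minpos_snd_nonneg: "Y \<ge> 0 \<Longrightarrow> minpos X Y = max 0 X - max 0 (X - Y)"
  by (auto simp: minpos_def max_def min_def)

lemma minpos_eq_0: "X \<le> 0 \<or> Y \<le> 0 \<Longrightarrow> minpos X Y = 0"
  by (auto simp: minpos_def max_def min_def)

text \<open>If a coordinate of r is large and positive, all six terms vanish. If it is large and
  negative, each \<open>minpos\<close> splits into two one-variable pieces that cancel in pairs
  between the six terms. This finite support is what makes the summands of F Laurent
  polynomials.\<close>

lemma weyl_coeff_eq_0:
  assumes "\<bar>fst r\<bar> > \<bar>n1\<bar> + \<bar>n2\<bar> \<or> \<bar>snd r\<bar> > \<bar>n1\<bar> + \<bar>n2\<bar>"
  shows "weyl_coeff n1 n2 r = 0"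
proof -
  obtain r1 r2 where r: "r = (r1, r2)" by (cases r)
  consider "r1 > \<bar>n1\<bar> + \<bar>n2\<bar>" | "- r1 > \<bar>n1\<bar> + \<bar>n2\<bar>" | "r2 > \<bar>n1\<bar> + \<bar>n2\<bar>" | "- r2 > \<bar>n1\<bar> + \<bar>n2\<bar>"
    using assms by (auto simp: r abs_if split: if_splits)
  then show ?thesis
  proof cases
    case 2
    then have "n1 - r1 \<ge> 0" "n2 - n1 - r1 \<ge> 0" "- n2 - r1 \<ge> 0" by auto
    then show ?thesis by (simp add: weyl_coeff_def r minpos_fst_nonneg)
  next
    case 4
    then have "n2 - r2 \<ge> 0" "n1 - n2 - r2 \<ge> 0" "- n1 - r2 \<ge> 0" by auto
    then show ?thesis by (simp add: weyl_coeff_def r minpos_snd_nonneg)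
  next
    case 1
    then have "n1 - r1 \<le> 0" "n2 - n1 - r1 \<le> 0" "- n2 - r1 \<le> 0" by auto
    then show ?thesis by (simp add: weyl_coeff_def r minpos_eq_0)
  next
    case 3
    then have "n2 - r2 \<le> 0" "n1 - n2 - r2 \<le> 0" "- n1 - r2 \<le> 0" by auto
    then show ?thesis by (simp add: weyl_coeff_def r minpos_eq_0)
  qed
qed

lemma finite_weyl_coeff: "finite {r. weyl_coeff n1 n2 r \<noteq> 0}"
proof (rule finite_subset)
  let ?B = "{- (\<bar>n1\<bar> + \<bar>n2\<bar>)..\<bar>n1\<bar> + \<bar>n2\<bar>}"
  show "{r. weyl_coeff n1 n2 r \<noteq> 0} \<subseteq> ?B \<times> ?B"
    using weyl_coeff_eq_0[of n1 n2] by (force simp: abs_le_iff not_less[symmetric])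
qed auto

lemma weyl_coeff_difference:
  "weyl_coeff n1 n2 (m1, m2) - weyl_coeff n1 n2 (m1 + 1, m2) - weyl_coeff n1 n2 (m1, m2 + 1)
     + weyl_coeff n1 n2 (m1 + 2, m2 + 1) + weyl_coeff n1 n2 (m1 + 1, m2 + 2) - weyl_coeff n1 n2 (m1 + 2, m2 + 2) =
   of_bool ((m1, m2) = (n1 - 1, n2 - 1)) - of_bool ((m1, m2) = (n2 - n1 - 1, n2 - 1))
     - of_bool ((m1, m2) = (n1 - 1, n1 - n2 - 1)) + of_bool ((m1, m2) = (- n2 - 1, n1 - n2 - 1))
     + of_bool ((m1, m2) = (n2 - n1 - 1, - n1 - 1)) - of_bool ((m1, m2) = (- n2 - 1, - n1 - 1))"
proof -
  define D where "D = (\<lambda>x y. minpos (x - m1) (y - m2) - minpos (x - (m1 + 1)) (y - m2) - minpos (x - m1) (y - (m2 + 1))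
    + minpos (x - (m1 + 2)) (y - (m2 + 1)) + minpos (x - (m1 + 1)) (y - (m2 + 2)) - minpos (x - (m1 + 2)) (y - (m2 + 2)))"
  have D: "D x y = of_bool ((m1, m2) = (x - 1, y - 1))" for x y
    using minpos_difference[of "x - m1" "y - m2"] by (auto simp: D_def diff_diff_eq)
  have "weyl_coeff n1 n2 (m1, m2) - weyl_coeff n1 n2 (m1 + 1, m2) - weyl_coeff n1 n2 (m1, m2 + 1)
     + weyl_coeff n1 n2 (m1 + 2, m2 + 1) + weyl_coeff n1 n2 (m1 + 1, m2 + 2) - weyl_coeff n1 n2 (m1 + 2, m2 + 2) =
     D n1 n2 - D (n2 - n1) n2 - D n1 (n1 - n2) + D (- n2) (n1 - n2) + D (n2 - n1) (- n1) - D (- n2) (- n1)"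
    by (simp add: D_def weyl_coeff_def)
  then show ?thesis by (simp only: D)
qed

text \<open>Multiplying by the Weyl denominator acts on coefficients by the shifts of
  \<open>minpos_difference\<close> and leaves exactly one monomial for each of the six numerator
  terms. The hypotheses on a and b make the denominator nonzero.\<close>

lemma Fsummand_eq_sum:
  assumes "a \<noteq> 0" "b \<noteq> 0" "a \<noteq> 1" "b \<noteq> 1" "a * b \<noteq> 1"
  shows "Fsummand n1 n2 a b = (\<Sum>m | weyl_coeff n1 n2 m \<noteq> 0. of_int (weyl_coeff n1 n2 m) * a powi fst m * b powi snd m)"
proof -
  define S where "S = (\<Sum>m | weyl_coeff n1 n2 m \<noteq> 0. of_int (weyl_coeff n1 n2 m) * a powi fst m * b powi snd m)"
  define c where "c = (\<lambda>m1 m2. of_int (weyl_coeff n1 n2 (m1, m2)) :: complex)"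
  have S: "((\<lambda>(m1,m2). c m1 m2 * (a powi m1 * b powi m2)) has_sum S) UNIV"
    by (rule has_sum_finite_neutralI[OF finite_weyl_coeff[of n1 n2]])
       (auto simp: S_def c_def case_prod_unfold mult_ac)
  have shift: "((\<lambda>(m1,m2). c (m1 + i) (m2 + j) * (a powi m1 * b powi m2)) has_sum (inverse (a powi i * b powi j) * S)) UNIV" for i j
  proof -
    have "((\<lambda>m. inverse (a powi i * b powi j) * (case m of (m1,m2) \<Rightarrow> c m1 m2 * (a powi m1 * b powi m2))) has_sum (inverse (a powi i * b powi j) * S)) UNIV"
      by (rule has_sum_cmult_right[OF S])
    also have "?this \<longleftrightarrow> ?thesis"
      by (rule has_sum_reindex_bij_witness[of _ "\<lambda>(m1,m2). (m1 + i, m2 + j)" "\<lambda>(m1,m2). (m1 - i, m2 - j)"])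
         (use assms in \<open>auto simp: power_int_diff field_simps\<close>)
    finally show ?thesis .
  qed
  have delta: "((\<lambda>(m1,m2). of_bool ((m1, m2) = (x, y)) * (a powi m1 * b powi m2)) has_sum (a powi x * b powi y)) UNIV" for x y
    by (rule has_sum_finite_neutralI[of "{(x, y)}"]) auto
  let ?T = "a powi (n1 - 1) * b powi (n2 - 1) - a powi (n2 - n1 - 1) * b powi (n2 - 1)
      - a powi (n1 - 1) * b powi (n1 - n2 - 1) + a powi (- n2 - 1) * b powi (n1 - n2 - 1)
      + a powi (n2 - n1 - 1) * b powi (- n1 - 1) - a powi (- n2 - 1) * b powi (- n1 - 1)"
  let ?U = "inverse (a powi 0 * b powi 0) * S - inverse (a powi 1 * b powi 0) * S - inverse (a powi 0 * b powi 1) * S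
    + inverse (a powi 2 * b powi 1) * S + inverse (a powi 1 * b powi 2) * S - inverse (a powi 2 * b powi 2) * S"
  define g where "g = (\<lambda>(m1,m2). of_int (weyl_coeff n1 n2 (m1, m2) - weyl_coeff n1 n2 (m1 + 1, m2) - weyl_coeff n1 n2 (m1, m2 + 1)
     + weyl_coeff n1 n2 (m1 + 2, m2 + 1) + weyl_coeff n1 n2 (m1 + 1, m2 + 2) - weyl_coeff n1 n2 (m1 + 2, m2 + 2)) * (a powi m1 * b powi m2))"
  have "(g has_sum ?U) UNIV"
  proof -
    have g: "g = (\<lambda>m. (case m of (m1,m2) \<Rightarrow> c (m1 + 0) (m2 + 0) * (a powi m1 * b powi m2))
      + - (case m of (m1,m2) \<Rightarrow> c (m1 + 1) (m2 + 0) * (a powi m1 * b powi m2))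
      + - (case m of (m1,m2) \<Rightarrow> c (m1 + 0) (m2 + 1) * (a powi m1 * b powi m2))
      + (case m of (m1,m2) \<Rightarrow> c (m1 + 2) (m2 + 1) * (a powi m1 * b powi m2))
      + (case m of (m1,m2) \<Rightarrow> c (m1 + 1) (m2 + 2) * (a powi m1 * b powi m2))
      + - (case m of (m1,m2) \<Rightarrow> c (m1 + 2) (m2 + 2) * (a powi m1 * b powi m2)))"
      by (auto simp: g_def c_def fun_eq_iff algebra_simps)
    show ?thesis unfolding g diff_conv_add_uminus by (intro has_sum_add has_sum_uminusI shift)
  qed
  moreover have "(g has_sum ?T) UNIV"
  proof -
    have g: "g = (\<lambda>m. (case m of (m1,m2) \<Rightarrow> of_bool ((m1, m2) = (n1 - 1, n2 - 1)) * (a powi m1 * b powi m2))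
      + - (case m of (m1,m2) \<Rightarrow> of_bool ((m1, m2) = (n2 - n1 - 1, n2 - 1)) * (a powi m1 * b powi m2))
      + - (case m of (m1,m2) \<Rightarrow> of_bool ((m1, m2) = (n1 - 1, n1 - n2 - 1)) * (a powi m1 * b powi m2))
      + (case m of (m1,m2) \<Rightarrow> of_bool ((m1, m2) = (- n2 - 1, n1 - n2 - 1)) * (a powi m1 * b powi m2))
      + (case m of (m1,m2) \<Rightarrow> of_bool ((m1, m2) = (n2 - n1 - 1, - n1 - 1)) * (a powi m1 * b powi m2))
      + - (case m of (m1,m2) \<Rightarrow> of_bool ((m1, m2) = (- n2 - 1, - n1 - 1)) * (a powi m1 * b powi m2)))"
      unfolding g_def weyl_coeff_difference
      by (rule ext) (simp only: case_prod_unfold of_int_add of_int_diff of_int_minus of_int_of_bool ring_distribs left_diff_distrib diff_conv_add_uminus minus_mult_left)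
    show ?thesis unfolding g diff_conv_add_uminus by (intro has_sum_add has_sum_uminusI delta)
  qed
  ultimately have UT: "?U = ?T" by (rule has_sum_unique)
  define A B where "A = inverse a" and "B = inverse b"
  have "?U = S * ((1 - A) * (1 - B) * (1 - A * B))"
    by (simp add: A_def[symmetric] B_def[symmetric] power2_eq_square algebra_simps)
  with UT have "S * ((1 - A) * (1 - B) * (1 - A * B)) = ?T" by simp
  moreover have "1 - A \<noteq> 0" "1 - B \<noteq> 0" "1 - A * B \<noteq> 0"
    using assms by (auto simp: A_def B_def field_simps)
  ultimately have "S = ?T / ((1 - A) * (1 - B) * (1 - A * B))"
    by (intro eq_divide_imp) auto
  then show ?thesis
    by (simp add: Fsummand_def S_def A_def B_def)
qed

lemma lpoly_coeff_Fsummand: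
  "lpoly_coeff (Fsummand n1 n2) r = of_int (weyl_coeff n1 n2 r)"
proof -
  have "lpoly_coeff (Fsummand n1 n2) = (\<lambda>m. of_int (weyl_coeff n1 n2 m))"
    unfolding lpoly_coeff_def
  proof (rule the_equality)
    show "finite {m. of_int (weyl_coeff n1 n2 m) \<noteq> (0::complex)} \<and>
     (\<forall>a b. a \<noteq> 0 \<and> b \<noteq> 0 \<and> a \<noteq> 1 \<and> b \<noteq> 1 \<and> a * b \<noteq> 1 \<longrightarrow>
        Fsummand n1 n2 a b = (\<Sum>m\<in>{m. of_int (weyl_coeff n1 n2 m) \<noteq> (0::complex)}. of_int (weyl_coeff n1 n2 m) * a powi fst m * b powi snd m))"
      using finite_weyl_coeff Fsummand_eq_sum by simp
  next
    fix c :: "int \<times> int \<Rightarrow> complex"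
    assume c: "finite {m. c m \<noteq> 0} \<and> (\<forall>a b. a \<noteq> 0 \<and> b \<noteq> 0 \<and> a \<noteq> 1 \<and> b \<noteq> 1 \<and> a * b \<noteq> 1 \<longrightarrow>
        Fsummand n1 n2 a b = (\<Sum>m\<in>{m. c m \<noteq> 0}. c m * a powi fst m * b powi snd m))"
    show "c = (\<lambda>m. of_int (weyl_coeff n1 n2 m))"
    proof
      fix m
      have "c m - of_int (weyl_coeff n1 n2 m) = 0"
      proof (rule laurent_coeff_unique2[where \<rho> = "1/2" and c = "\<lambda>m. c m - of_int (weyl_coeff n1 n2 m)"])
        \<comment> \<open>At radius 1/2 neither a nor b nor a b, which has norm 1/4, meets the
          excluded value 1.\<close>
        fix a b :: complex assume ab: "norm a = 1/2" "norm b = 1/2"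
        then have "norm (a * b) = 1/4" by (simp only: norm_mult)
        with ab have nz: "a \<noteq> 0" "b \<noteq> 0" "a \<noteq> 1" "b \<noteq> 1" "a * b \<noteq> 1" by auto
        have "((\<lambda>m. c m * a powi fst m * b powi snd m) has_sum Fsummand n1 n2 a b) UNIV"
          by (rule has_sum_finite_neutralI[of "{m. c m \<noteq> 0}"]) (use c nz in auto)
        moreover have "((\<lambda>m. of_int (weyl_coeff n1 n2 m) * a powi fst m * b powi snd m) has_sum Fsummand n1 n2 a b) UNIV"
          by (rule has_sum_finite_neutralI[OF finite_weyl_coeff[of n1 n2]]) (use Fsummand_eq_sum[OF nz] in auto)
        ultimately have "((\<lambda>m. c m * a powi fst m * b powi snd m + - (of_int (weyl_coeff n1 n2 m) * a powi fst m * b powi snd m))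
            has_sum (Fsummand n1 n2 a b + - Fsummand n1 n2 a b)) UNIV"
          by (intro has_sum_add has_sum_uminusI)
        then show "((\<lambda>m. (c m - of_int (weyl_coeff n1 n2 m)) * a powi fst m * b powi snd m) has_sum 0) UNIV"
          by (simp add: algebra_simps)
      qed auto
      then show "c m = of_int (weyl_coeff n1 n2 m)" by simp
    qed
  qed
  then show ?thesis by simp
qed

section \<open>Cone sums\<close>

definition qform :: "int \<Rightarrow> int \<Rightarrow> int" where
  "qform x y = 2 * (x * x + y * y - x * y)"

lemma summable_on_gauss_linear:
  fixes t c :: real
  assumes "0 < t" "t < 1" "c \<ge> 0"
  shows "(\<lambda>k::int. t powi (k * k + \<alpha> * k) * c ^ nat \<bar>k\<bar>) summable_on UNIV"
proof (rule summable_on_comparison_test)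
  define d where "d = t powi \<alpha> + inverse (t powi \<alpha>)"
  show "(\<lambda>k::int. t powi (k * k) * (d * c) ^ nat \<bar>k\<bar>) summable_on UNIV"
    using assms by (intro summable_on_gauss_abs) (auto simp: d_def)
  fix k :: int
  have "(t powi \<alpha>) powi k \<le> d ^ nat \<bar>k\<bar>"
    using assms by (intro power_int_le_nat_abs_power) (auto simp: d_def)
  then have "t powi (k * k) * (t powi \<alpha>) powi k * c ^ nat \<bar>k\<bar> \<le> t powi (k * k) * d ^ nat \<bar>k\<bar> * c ^ nat \<bar>k\<bar>"
    using assms by (intro mult_right_mono mult_left_mono) auto
  then show "t powi (k * k + \<alpha> * k) * c ^ nat \<bar>k\<bar> \<le> t powi (k * k) * (d * c) ^ nat \<bar>k\<bar>"
    using assms by (simp add: power_int_add power_int_mult power_mult_distrib mult_ac)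
qed (use assms in auto)

lemma summable_on_minpos:
  fixes q :: complex
  assumes q: "q \<noteq> 0" "norm q < 1"
  shows "(\<lambda>(m1,m2). of_int (minpos (m1 + u) (m2 + v)) * q powi (qform m1 m2 + \<alpha> * m1 + \<beta> * m2)) summable_on UNIV"
proof (rule summable_on_norm_bound)
  let ?t = "norm q" and ?K = "1 + real_of_int \<bar>u\<bar>"
  have nn: "0 \<le> ?t powi k" for k by simp
  have "(\<lambda>k. norm (?K * (?t powi (k * k + \<alpha> * k) * 2 ^ nat \<bar>k\<bar>))) summable_on UNIV"
    using summable_on_cmult_right[OF summable_on_gauss_linear[of ?t 2 \<alpha>], of ?K] q by (simp add: abs_mult)
  moreover have "(\<lambda>k. norm (?t powi (k * k + \<beta> * k) * 1 ^ nat \<bar>k\<bar>)) summable_on UNIV"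
    using summable_on_gauss_linear[of ?t 1 \<beta>] q by (simp add: abs_mult)
  ultimately show "(\<lambda>(m1,m2). norm (?K * (?t powi (m1 * m1 + \<alpha> * m1) * 2 ^ nat \<bar>m1\<bar>) * (?t powi (m2 * m2 + \<beta> * m2) * 1 ^ nat \<bar>m2\<bar>))) summable_on UNIV"
    using summable_on_norm_times by fastforce
  fix m :: "int \<times> int"
  obtain m1 m2 where m: "m = (m1, m2)" by (cases m)
  have "real_of_int \<bar>m1\<bar> \<le> 2 ^ nat \<bar>m1\<bar>"
    using of_nat_less_two_power[of "nat \<bar>m1\<bar>", where 'a = real] by simp
  moreover have "real_of_int \<bar>u\<bar> * 1 \<le> real_of_int \<bar>u\<bar> * 2 ^ nat \<bar>m1\<bar>" by (intro mult_left_mono) auto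
  ultimately have "real_of_int \<bar>m1 + u\<bar> \<le> ?K * 2 ^ nat \<bar>m1\<bar>"
    using abs_triangle_ineq[of "real_of_int m1" "real_of_int u"] by (simp add: algebra_simps)
  moreover have "\<bar>real_of_int (minpos (m1 + u) (m2 + v))\<bar> \<le> real_of_int \<bar>m1 + u\<bar>"
    by (auto simp: minpos_def max_def min_def)
  ultimately have 1: "\<bar>real_of_int (minpos (m1 + u) (m2 + v))\<bar> \<le> ?K * 2 ^ nat \<bar>m1\<bar>" by linarith
  \<comment> \<open>The form exceeds m1^2 + m2^2 by a square, so the lattice sum is dominated by a
    product of two one-dimensional Gaussian sums; the linear growth of \<open>minpos\<close> has
    been absorbed into a power of 2.\<close>
  have "qform m1 m2 = m1 * m1 + m2 * m2 + (m1 - m2) * (m1 - m2)"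
    by (simp add: qform_def algebra_simps)
  then have "(m1 * m1 + \<alpha> * m1) + (m2 * m2 + \<beta> * m2) \<le> qform m1 m2 + \<alpha> * m1 + \<beta> * m2" by simp
  then have "?t powi (qform m1 m2 + \<alpha> * m1 + \<beta> * m2) \<le> ?t powi ((m1 * m1 + \<alpha> * m1) + (m2 * m2 + \<beta> * m2))"
    using q by (intro power_int_decreasing) auto
  then have 2: "?t powi (qform m1 m2 + \<alpha> * m1 + \<beta> * m2) \<le> ?t powi (m1 * m1 + \<alpha> * m1) * ?t powi (m2 * m2 + \<beta> * m2)"
    using q by (simp add: power_int_add)
  show "norm (case m of (m1,m2) \<Rightarrow> of_int (minpos (m1 + u) (m2 + v)) * q powi (qform m1 m2 + \<alpha> * m1 + \<beta> * m2)) \<le>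
    (case m of (m1,m2) \<Rightarrow> norm (?K * (?t powi (m1 * m1 + \<alpha> * m1) * 2 ^ nat \<bar>m1\<bar>) * (?t powi (m2 * m2 + \<beta> * m2) * 1 ^ nat \<bar>m2\<bar>)))"
    using mult_mono[OF 1 2] by (simp add: m norm_mult norm_power_int abs_mult mult_ac)
qed

lemma has_sum_minpos_difference:
  fixes q :: complex
  assumes f: "((\<lambda>(m1,m2). of_int (minpos (m1 + u) (m2 + v)) * q powi (qform m1 m2 + \<alpha> * m1 + \<beta> * m2)) has_sum F) UNIV"
    and g: "((\<lambda>(m1,m2). of_int (minpos (m1 + u') (m2 + v')) * q powi (qform m1 m2 + \<alpha> * m1 + \<beta> * m2)) has_sum G) UNIV"
    and S: "\<And>m1 m2. minpos (m1 + u) (m2 + v) - minpos (m1 + u') (m2 + v') = of_bool ((m1, m2) \<in> S)"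
  shows "((\<lambda>(m1,m2). q powi (qform m1 m2 + \<alpha> * m1 + \<beta> * m2)) has_sum (F - G)) S"
proof -
  have "((\<lambda>m. (case m of (m1,m2) \<Rightarrow> of_int (minpos (m1 + u) (m2 + v)) * q powi (qform m1 m2 + \<alpha> * m1 + \<beta> * m2)) -
     (case m of (m1,m2) \<Rightarrow> of_int (minpos (m1 + u') (m2 + v')) * q powi (qform m1 m2 + \<alpha> * m1 + \<beta> * m2))) has_sum (F - G)) UNIV"
    by (rule has_sum_diff[OF f g])
  also have "(\<lambda>m. (case m of (m1,m2) \<Rightarrow> of_int (minpos (m1 + u) (m2 + v)) * q powi (qform m1 m2 + \<alpha> * m1 + \<beta> * m2)) -
     (case m of (m1,m2) \<Rightarrow> of_int (minpos (m1 + u') (m2 + v')) * q powi (qform m1 m2 + \<alpha> * m1 + \<beta> * m2))) =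
     (\<lambda>m. of_bool (m \<in> S) * (case m of (m1,m2) \<Rightarrow> q powi (qform m1 m2 + \<alpha> * m1 + \<beta> * m2)))"
  proof
    fix m :: "int \<times> int"
    obtain m1 m2 where m: "m = (m1, m2)" by (cases m)
    have "of_int (minpos (m1 + u) (m2 + v)) - of_int (minpos (m1 + u') (m2 + v')) = (of_bool ((m1, m2) \<in> S) :: complex)"
      using S[of m1 m2] by (metis of_int_diff of_int_of_bool)
    then show "(case m of (m1,m2) \<Rightarrow> of_int (minpos (m1 + u) (m2 + v)) * q powi (qform m1 m2 + \<alpha> * m1 + \<beta> * m2)) -
     (case m of (m1,m2) \<Rightarrow> of_int (minpos (m1 + u') (m2 + v')) * q powi (qform m1 m2 + \<alpha> * m1 + \<beta> * m2)) =
      of_bool (m \<in> S) * (case m of (m1,m2) \<Rightarrow> q powi (qform m1 m2 + \<alpha> * m1 + \<beta> * m2))"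
      by (simp add: m left_diff_distrib[symmetric])
  qed
  finally show ?thesis
    by (subst has_sum_cong_neutral[where T = UNIV and g = "\<lambda>m. of_bool (m \<in> S) * (case m of (m1,m2) \<Rightarrow> q powi (qform m1 m2 + \<alpha> * m1 + \<beta> * m2))"]) auto
qed

text \<open>Each of the six Weyl group terms is moved by its own lattice automorphism so that they pair up
  into three differences with equal \<open>q\<close>-exponents; the linear growth of \<open>minpos\<close> then collapses to
  indicator functions of cones.\<close>
lemma has_sum_weyl_coeff:
  fixes q :: complex
  assumes q: "q \<noteq> 0" "norm q < 1"
  obtains SA SB SC where
    "((\<lambda>(m1,m2). q powi (qform m1 m2 + 1 * m1 + 1 * m2)) has_sum SA) {(m1,m2). r1 \<le> m1 \<and> r2 \<le> m2}"
    "((\<lambda>(m1,m2). q powi (qform m1 m2 + 2 * m1 + - 1 * m2)) has_sum SB) {(m1,m2). r1 \<le> m1 \<and> m1 - r1 < m2 - r2}"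
    "((\<lambda>(m1,m2). q powi (qform m1 m2 + - 1 * m1 + 2 * m2)) has_sum SC) {(m1,m2). r2 \<le> m2 \<and> m2 - r2 < m1 - r1}"
    "((\<lambda>(n1,n2). q powi (qform n1 n2 - n1 - n2) * of_int (weyl_coeff n1 n2 (r1, r2))) has_sum (SA - SB - SC)) UNIV"
proof -
  let ?f = "\<lambda>\<alpha> \<beta> u v. (\<lambda>(m1,m2). of_int (minpos (m1 + u) (m2 + v)) * q powi (qform m1 m2 + \<alpha> * m1 + \<beta> * m2))"
  define T where "T = (\<lambda>\<alpha> \<beta> u v. infsum (?f \<alpha> \<beta> u v) UNIV)"
  have T: "(?f \<alpha> \<beta> u v has_sum T \<alpha> \<beta> u v) UNIV" for \<alpha> \<beta> u v
    unfolding T_def by (rule has_sum_infsum[OF summable_on_minpos[OF q]])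
  define g where "g = (\<lambda>n1 n2. q powi (qform n1 n2 - n1 - n2))"
  have t1: "((\<lambda>(n1,n2). g n1 n2 * of_int (minpos (n1 - r1) (n2 - r2))) has_sum T 1 1 (1 - r1) (1 - r2)) UNIV"
    by (rule iffD2[OF has_sum_reindex_bij_witness[of UNIV "\<lambda>(m1,m2). (m1 + 1, m2 + 1)" "\<lambda>(n1,n2). (n1 - 1, n2 - 1)" UNIV "?f 1 1 (1 - r1) (1 - r2)"] T])
       (auto simp: g_def qform_def algebra_simps)
  have t6: "((\<lambda>(n1,n2). g n1 n2 * of_int (minpos (- n2 - r1) (- n1 - r2))) has_sum T 1 1 (- r1) (- r2)) UNIV"
    by (rule iffD2[OF has_sum_reindex_bij_witness[of UNIV "\<lambda>(m1,m2). (- m2, - m1)" "\<lambda>(n1,n2). (- n2, - n1)" UNIV "?f 1 1 (- r1) (- r2)"] T])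
       (auto simp: g_def qform_def algebra_simps)
  have t2: "((\<lambda>(n1,n2). g n1 n2 * of_int (minpos (n2 - n1 - r1) (n2 - r2))) has_sum T (- 1) 2 (- r1) (1 - r2)) UNIV"
    by (rule iffD2[OF has_sum_reindex_bij_witness[of UNIV "\<lambda>(m1,m2). (m2 + 1 - m1, m2 + 1)" "\<lambda>(n1,n2). (n2 - n1, n2 - 1)" UNIV "?f (- 1) 2 (- r1) (1 - r2)"] T])
       (auto simp: g_def qform_def algebra_simps)
  have t5: "((\<lambda>(n1,n2). g n1 n2 * of_int (minpos (n2 - n1 - r1) (- n1 - r2))) has_sum T (- 1) 2 (- r1) (- r2)) UNIV"
    by (rule iffD2[OF has_sum_reindex_bij_witness[of UNIV "\<lambda>(m1,m2). (- m2, m1 - m2)" "\<lambda>(n1,n2). (n2 - n1, - n1)" UNIV "?f (- 1) 2 (- r1) (- r2)"] T])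
       (auto simp: g_def qform_def algebra_simps)
  have t3: "((\<lambda>(n1,n2). g n1 n2 * of_int (minpos (n1 - r1) (n1 - n2 - r2))) has_sum T 2 (- 1) (1 - r1) (- r2)) UNIV"
    by (rule iffD2[OF has_sum_reindex_bij_witness[of UNIV "\<lambda>(m1,m2). (m1 + 1, m1 + 1 - m2)" "\<lambda>(n1,n2). (n1 - 1, n1 - n2)" UNIV "?f 2 (- 1) (1 - r1) (- r2)"] T])
       (auto simp: g_def qform_def algebra_simps)
  have t4: "((\<lambda>(n1,n2). g n1 n2 * of_int (minpos (- n2 - r1) (n1 - n2 - r2))) has_sum T 2 (- 1) (- r1) (- r2)) UNIV"
    by (rule iffD2[OF has_sum_reindex_bij_witness[of UNIV "\<lambda>(m1,m2). (m2 - m1, - m1)" "\<lambda>(n1,n2). (- n2, n1 - n2)" UNIV "?f 2 (- 1) (- r1) (- r2)"] T])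
       (auto simp: g_def qform_def algebra_simps)
  have "((\<lambda>n. (case n of (n1,n2) \<Rightarrow> g n1 n2 * of_int (minpos (n1 - r1) (n2 - r2)))
     - (case n of (n1,n2) \<Rightarrow> g n1 n2 * of_int (minpos (n2 - n1 - r1) (n2 - r2)))
     - (case n of (n1,n2) \<Rightarrow> g n1 n2 * of_int (minpos (n1 - r1) (n1 - n2 - r2)))
     + (case n of (n1,n2) \<Rightarrow> g n1 n2 * of_int (minpos (- n2 - r1) (n1 - n2 - r2)))
     + (case n of (n1,n2) \<Rightarrow> g n1 n2 * of_int (minpos (n2 - n1 - r1) (- n1 - r2)))
     - (case n of (n1,n2) \<Rightarrow> g n1 n2 * of_int (minpos (- n2 - r1) (- n1 - r2)))) has_sum
     (T 1 1 (1 - r1) (1 - r2) - T (- 1) 2 (- r1) (1 - r2) - T 2 (- 1) (1 - r1) (- r2) + T 2 (- 1) (- r1) (- r2)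
      + T (- 1) 2 (- r1) (- r2) - T 1 1 (- r1) (- r2))) UNIV"
    by (intro has_sum_add has_sum_diff t1 t2 t3 t4 t5 t6)
  then have "((\<lambda>(n1,n2). q powi (qform n1 n2 - n1 - n2) * of_int (weyl_coeff n1 n2 (r1, r2))) has_sum
     ((T 1 1 (1 - r1) (1 - r2) - T 1 1 (- r1) (- r2)) - (T 2 (- 1) (1 - r1) (- r2) - T 2 (- 1) (- r1) (- r2))
      - (T (- 1) 2 (- r1) (1 - r2) - T (- 1) 2 (- r1) (- r2)))) UNIV"
    by (simp add: case_prod_unfold g_def weyl_coeff_def algebra_simps)
  \<comment> \<open>In this pair the arguments differ by (1, 1), which raises the minimum throughout
    the quadrant. In the next two pairs only one coordinate is shifted, which raises it only where
    that coordinate is the strictly smaller one.\<close>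
  moreover have "((\<lambda>(m1,m2). q powi (qform m1 m2 + 1 * m1 + 1 * m2)) has_sum (T 1 1 (1 - r1) (1 - r2) - T 1 1 (- r1) (- r2))) {(m1,m2). r1 \<le> m1 \<and> r2 \<le> m2}"
    by (rule has_sum_minpos_difference[OF T T]) (auto simp: minpos_def max_def min_def)
  moreover have "((\<lambda>(m1,m2). q powi (qform m1 m2 + 2 * m1 + - 1 * m2)) has_sum (T 2 (- 1) (1 - r1) (- r2) - T 2 (- 1) (- r1) (- r2))) {(m1,m2). r1 \<le> m1 \<and> m1 - r1 < m2 - r2}"
    by (rule has_sum_minpos_difference[OF T T]) (auto simp: minpos_def max_def min_def)
  moreover have "((\<lambda>(m1,m2). q powi (qform m1 m2 + - 1 * m1 + 2 * m2)) has_sum (T (- 1) 2 (- r1) (1 - r2) - T (- 1) 2 (- r1) (- r2))) {(m1,m2). r2 \<le> m2 \<and> m2 - r2 < m1 - r1}"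
    by (rule has_sum_minpos_difference[OF T T]) (auto simp: minpos_def max_def min_def)
  ultimately show ?thesis using that by blast
qed

lemma qform_commute: "qform x y = qform y x"
  by (simp add: qform_def)

text \<open>The terms of \<open>ptheta\<close> with even index \<open>k = 2 d\<close> come from the first family, those with odd
  \<open>k = 2 d - 1\<close> from the second.\<close>
lemma has_sum_wedge:
  fixes s :: complex
  assumes s: "s \<noteq> 0" "norm s < 1" and c: "c = 0 \<or> c = 1"
    and SA: "((\<lambda>(n,d). (s\<^sup>2) powi (qform (r1 + n) (r2 + n + d) + (r1 + n) + (r2 + n + d))) has_sum SA) ({0..} \<times> {c..})"
    and SB: "((\<lambda>(n,d). (s\<^sup>2) powi (qform (r1 + n) (r2 + n + d) + 2 * (r1 + n) - (r2 + n + d))) has_sum SB) ({0..} \<times> {1..})"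
  shows "((\<lambda>n. (s\<^sup>2) powi qform r1 r2 * (s\<^sup>2) powi (2 * n * (n + 1) + (r1 + r2) * (2 * n + 1)) *
     (ptheta s (n + (2 * r2 - r1)) - of_int c)) has_sum (SA - SB)) {0..}"
proof -
  define \<Phi> where "\<Phi> = (\<lambda>(n,k). (s\<^sup>2) powi qform r1 r2 * (s\<^sup>2) powi (2 * n * (n + 1) + (r1 + r2) * (2 * n + 1)) *
     ((-1) powi k * s powi (k * (k + 1) + 2 * k * (n + (2 * r2 - r1)))))"
  have \<Phi>: "\<Phi> (n, k) = (-1) powi k * s powi (2 * qform r1 r2 + 2 * (2 * n * (n + 1) + (r1 + r2) * (2 * n + 1)) +
     (k * (k + 1) + 2 * k * (n + (2 * r2 - r1))))" for n k
    using s by (simp add: \<Phi>_def power_int_add power_int_power mult_ac)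
  have "(\<Phi> has_sum SA) ({0..} \<times> {k. c \<le> k \<and> even k})"
  proof (rule iffD1[OF has_sum_reindex_bij_witness[of _ "\<lambda>(n,k). (n, k div 2)" "\<lambda>(n,d). (n, 2 * d)"] SA])
    fix x :: "int \<times> int"
    obtain n d where x: "x = (n, d)" by (cases x)
    have "2 * qform r1 r2 + 2 * (2 * n * (n + 1) + (r1 + r2) * (2 * n + 1)) +
       (2 * d * (2 * d + 1) + 2 * (2 * d) * (n + (2 * r2 - r1))) = 2 * (qform (r1 + n) (r2 + n + d) + (r1 + n) + (r2 + n + d))"
      by (simp add: qform_def algebra_simps)
    then show "\<Phi> (case x of (n,d) \<Rightarrow> (n, 2 * d)) = (case x of (n,d) \<Rightarrow> (s\<^sup>2) powi (qform (r1 + n) (r2 + n + d) + (r1 + n) + (r2 + n + d)))"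
      by (simp add: x \<Phi> power_int_power)
  qed (use c in auto)
  moreover have "(\<Phi> has_sum (- SB)) ({0..} \<times> {k. c \<le> k \<and> odd k})"
  proof (rule iffD1[OF has_sum_reindex_bij_witness[of _ "\<lambda>(n,k). (n, (k + 1) div 2)" "\<lambda>(n,d). (n, 2 * d - 1)"] has_sum_uminusI[OF SB]])
    fix x :: "int \<times> int"
    obtain n d where x: "x = (n, d)" by (cases x)
    have "2 * qform r1 r2 + 2 * (2 * n * (n + 1) + (r1 + r2) * (2 * n + 1)) +
       ((2 * d - 1) * (2 * d - 1 + 1) + 2 * (2 * d - 1) * (n + (2 * r2 - r1))) = 2 * (qform (r1 + n) (r2 + n + d) + 2 * (r1 + n) - (r2 + n + d))"
      by (simp add: qform_def algebra_simps)
    then show "\<Phi> (case x of (n,d) \<Rightarrow> (n, 2 * d - 1)) = - (case x of (n,d) \<Rightarrow> (s\<^sup>2) powi (qform (r1 + n) (r2 + n + d) + 2 * (r1 + n) - (r2 + n + d)))"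
      by (simp add: x \<Phi> power_int_power)
  qed (use c in \<open>auto elim!: oddE\<close>)
  ultimately have "(\<Phi> has_sum (SA + - SB)) ({0..} \<times> {k. c \<le> k \<and> even k} \<union> {0..} \<times> {k. c \<le> k \<and> odd k})"
    by (rule has_sum_Un_disjoint) auto
  also have "{0..} \<times> {k. c \<le> k \<and> even k} \<union> {0..} \<times> {k. c \<le> k \<and> odd k} = {0..} \<times> {c..}" by auto
  finally have "(\<Phi> has_sum (SA - SB)) ({0..} \<times> {c..})" by simp
  then show ?thesis
  proof (rule has_sum_SigmaD)
    fix n :: int
    \<comment> \<open>For c = 1 the diagonal d = 0 is excluded from the wedge; it corresponds to k =
      0, whose term is 1, hence the subtracted c.\<close>
    have "((\<lambda>k. (-1) powi k * s powi (k * (k + 1) + 2 * k * (n + (2 * r2 - r1)))) has_sum (ptheta s (n + (2 * r2 - r1)) - of_int c)) {c..}"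
    proof (cases "c = 0")
      case True
      then show ?thesis using ptheta_has_sum[OF s] by simp
    next
      case False
      with c have c1: "c = 1" by simp
      have "((\<lambda>k. (-1) powi k * s powi (k * (k + 1) + 2 * k * (n + (2 * r2 - r1)))) has_sum (ptheta s (n + (2 * r2 - r1)) - 1)) ({0..} - {0})"
        by (rule has_sum_Diff[OF ptheta_has_sum[OF s]]) (auto intro!: has_sum_finiteI)
      also have "{0..} - {0} = {1 :: int..}" by auto
      finally show ?thesis by (simp add: c1)
    qed
    from has_sum_cmult_right[OF this]
    show "((\<lambda>k. \<Phi> (n, k)) has_sum ((s\<^sup>2) powi qform r1 r2 * (s\<^sup>2) powi (2 * n * (n + 1) + (r1 + r2) * (2 * n + 1)) *
     (ptheta s (n + (2 * r2 - r1)) - of_int c))) {c..}" by (simp add: \<Phi>_def)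
  qed
qed

text \<open>The quadrant is cut along its diagonal into a closed and an open wedge, each paired with
  one of the other two cone sums; the second pair is treated like the first with r1 and r2
  exchanged. The wedges contribute \<open>ptheta\<close> at n + 2 r2 - r1 and at n + 2 r1 - r2 with
  a common weight depending on r1 + r2, which is the origin of the index (2 r1 - r2, r1 +
  r2).\<close>

lemma has_sum_weyl_coeff_eq_quotient_coeff:
  fixes s :: complex
  assumes s: "s \<noteq> 0" "norm s < 1"
  shows "((\<lambda>(n1,n2). (s\<^sup>2) powi (qform n1 n2 - n1 - n2) * of_int (weyl_coeff n1 n2 (r1, r2))) has_sum
    ((s\<^sup>2) powi qform r1 r2 * quotient_coeff s (2 * r1 - r2) (r1 + r2))) UNIV"
proof -
  define q where "q = s\<^sup>2"
  have q: "q \<noteq> 0" "norm q < 1" using s by (auto simp: q_def norm_power power_less_one_iff)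
  obtain SA SB SC where
    SA: "((\<lambda>(m1,m2). q powi (qform m1 m2 + 1 * m1 + 1 * m2)) has_sum SA) {(m1,m2). r1 \<le> m1 \<and> r2 \<le> m2}" and
    SB: "((\<lambda>(m1,m2). q powi (qform m1 m2 + 2 * m1 + - 1 * m2)) has_sum SB) {(m1,m2). r1 \<le> m1 \<and> m1 - r1 < m2 - r2}" and
    SC: "((\<lambda>(m1,m2). q powi (qform m1 m2 + - 1 * m1 + 2 * m2)) has_sum SC) {(m1,m2). r2 \<le> m2 \<and> m2 - r2 < m1 - r1}" and
    total: "((\<lambda>(n1,n2). q powi (qform n1 n2 - n1 - n2) * of_int (weyl_coeff n1 n2 (r1, r2))) has_sum (SA - SB - SC)) UNIV"
    by (rule has_sum_weyl_coeff[OF q, of r1 r2])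
  let ?h = "\<lambda>(m1,m2). q powi (qform m1 m2 + 1 * m1 + 1 * m2)"
  define A1 where "A1 = {(m1,m2). r1 \<le> m1 \<and> m1 - r1 \<le> m2 - r2}"
  define A2 where "A2 = {(m1,m2). r2 \<le> m2 \<and> m2 - r2 < m1 - r1}"
  have A: "{(m1,m2). r1 \<le> m1 \<and> r2 \<le> m2} = A1 \<union> A2" "A1 \<inter> A2 = {}"
    by (auto simp: A1_def A2_def)
  have summable: "?h summable_on A1" "?h summable_on A2"
    using summable_on_subset[OF has_sum_imp_summable[OF SA]] unfolding A(1) by blast+
  have SA_eq: "SA = infsum ?h A1 + infsum ?h A2"
    using has_sum_Un_disjoint[OF has_sum_infsum[OF summable(1)] has_sum_infsum[OF summable(2)] A(2)] SA
    unfolding A(1) using has_sum_unique by blast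
  have 1: "((\<lambda>(n,d). q powi (qform (r1 + n) (r2 + n + d) + (r1 + n) + (r2 + n + d))) has_sum infsum ?h A1) ({0..} \<times> {0..})"
    by (rule iffD1[OF has_sum_reindex_bij_witness[of _ "\<lambda>(n,d). (r1 + n, r2 + n + d)" "\<lambda>(m1,m2). (m1 - r1, (m2 - r2) - (m1 - r1))"] has_sum_infsum[OF summable(1)]])
       (auto simp: A1_def algebra_simps)
  have 2: "((\<lambda>(n,d). q powi (qform (r2 + n) (r1 + n + d) + (r2 + n) + (r1 + n + d))) has_sum infsum ?h A2) ({0..} \<times> {1..})"
    by (rule iffD1[OF has_sum_reindex_bij_witness[of _ "\<lambda>(n,d). (r1 + n + d, r2 + n)" "\<lambda>(m1,m2). (m2 - r2, (m1 - r1) - (m2 - r2))"] has_sum_infsum[OF summable(2)]])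
       (auto simp: A2_def qform_commute algebra_simps)
  have 3: "((\<lambda>(n,d). q powi (qform (r1 + n) (r2 + n + d) + 2 * (r1 + n) - (r2 + n + d))) has_sum SB) ({0..} \<times> {1..})"
    by (rule iffD1[OF has_sum_reindex_bij_witness[of _ "\<lambda>(n,d). (r1 + n, r2 + n + d)" "\<lambda>(m1,m2). (m1 - r1, (m2 - r2) - (m1 - r1))"] SB])
       (auto simp: algebra_simps)
  have 4: "((\<lambda>(n,d). q powi (qform (r2 + n) (r1 + n + d) + 2 * (r2 + n) - (r1 + n + d))) has_sum SC) ({0..} \<times> {1..})"
    by (rule iffD1[OF has_sum_reindex_bij_witness[of _ "\<lambda>(n,d). (r1 + n + d, r2 + n)" "\<lambda>(m1,m2). (m2 - r2, (m1 - r1) - (m2 - r2))"] SC])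
       (auto simp: qform_commute algebra_simps)
  have "((\<lambda>n. q powi qform r1 r2 * q powi (2 * n * (n + 1) + (r1 + r2) * (2 * n + 1)) * (ptheta s (n + (2 * r2 - r1)) - of_int 0) +
       q powi qform r2 r1 * q powi (2 * n * (n + 1) + (r2 + r1) * (2 * n + 1)) * (ptheta s (n + (2 * r1 - r2)) - of_int 1)) has_sum
     ((infsum ?h A1 - SB) + (infsum ?h A2 - SC))) {0..}"
    unfolding q_def
    by (intro has_sum_add has_sum_wedge[OF s _ 1[unfolded q_def] 3[unfolded q_def]] has_sum_wedge[OF s _ 2[unfolded q_def] 4[unfolded q_def]]) auto
  also have "(infsum ?h A1 - SB) + (infsum ?h A2 - SC) = SA - SB - SC"
    by (simp add: SA_eq)
  also have "(\<lambda>n. q powi qform r1 r2 * q powi (2 * n * (n + 1) + (r1 + r2) * (2 * n + 1)) * (ptheta s (n + (2 * r2 - r1)) - of_int 0) +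
       q powi qform r2 r1 * q powi (2 * n * (n + 1) + (r2 + r1) * (2 * n + 1)) * (ptheta s (n + (2 * r1 - r2)) - of_int 1)) =
     (\<lambda>n. q powi qform r1 r2 * (q powi (2 * n * (n + 1) + (r1 + r2) * (2 * n + 1)) *
        (ptheta s (n + (2 * r1 - r2)) - ptheta s ((2 * r1 - r2) - n - 1 - (r1 + r2)))))"
  proof
    fix n :: int
    \<comment> \<open>The reflection brings the index into the form required by
      \<open>quotient_coeff\<close>; its 1 cancels the -1 contributed by the open wedge.\<close>
    have eq: "ptheta s (n + (2 * r2 - r1)) = 1 - ptheta s ((2 * r1 - r2) - n - 1 - (r1 + r2))"
      using ptheta_reflect[OF s, of "n + (2 * r2 - r1)"] by (simp add: algebra_simps)
    show "q powi qform r1 r2 * q powi (2 * n * (n + 1) + (r1 + r2) * (2 * n + 1)) * (ptheta s (n + (2 * r2 - r1)) - of_int 0) +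
       q powi qform r2 r1 * q powi (2 * n * (n + 1) + (r2 + r1) * (2 * n + 1)) * (ptheta s (n + (2 * r1 - r2)) - of_int 1) =
      q powi qform r1 r2 * (q powi (2 * n * (n + 1) + (r1 + r2) * (2 * n + 1)) *
        (ptheta s (n + (2 * r1 - r2)) - ptheta s ((2 * r1 - r2) - n - 1 - (r1 + r2))))"
      unfolding eq qform_commute[of r2 r1] add.commute[of r2 r1] by (simp add: algebra_simps)
  qed
  finally have "((\<lambda>n. q powi qform r1 r2 * (q powi (2 * n * (n + 1) + (r1 + r2) * (2 * n + 1)) *
        (ptheta s (n + (2 * r1 - r2)) - ptheta s ((2 * r1 - r2) - n - 1 - (r1 + r2))))) has_sum (SA - SB - SC)) {0..}" .
  moreover have "((\<lambda>n. q powi qform r1 r2 * (q powi (2 * n * (n + 1) + (r1 + r2) * (2 * n + 1)) *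
        (ptheta s (n + (2 * r1 - r2)) - ptheta s ((2 * r1 - r2) - n - 1 - (r1 + r2))))) has_sum
      (q powi qform r1 r2 * quotient_coeff s (2 * r1 - r2) (r1 + r2))) {0..}"
    unfolding quotient_coeff_def q_def by (intro has_sum_cmult_right has_sum_infsum summable_on_quotient_coeff[OF s])
  ultimately have "SA - SB - SC = q powi qform r1 r2 * quotient_coeff s (2 * r1 - r2) (r1 + r2)"
    by (rule has_sum_unique)
  with total show ?thesis by (simp add: q_def)
qed

section \<open>The modular setting\<close>

lemma qpow_add: "qpow \<tau> (x + y) = qpow \<tau> x * qpow \<tau> y"
  by (simp add: qpow_def exp_add[symmetric] algebra_simps)

lemma qpow_nonzero [simp]: "qpow \<tau> x \<noteq> 0"
  by (simp add: qpow_def)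

lemma qpow_power: "qpow \<tau> x ^ n = qpow \<tau> (real n * x)"
  by (simp add: qpow_def exp_of_nat_mult[symmetric] mult_ac)

lemma qpow_diff: "qpow \<tau> (x - y) = qpow \<tau> x / qpow \<tau> y"
  using qpow_add[of \<tau> "x - y" y] by (simp add: field_simps)

lemma qpow_double: "qpow (2 * \<tau>) x = qpow \<tau> (2 * x)"
  by (simp add: qpow_def mult_ac)

lemma power_int_exp: "exp z powi k = exp (of_int k * z :: complex)"
  by (simp add: exp_power_int mult.commute)

lemma qpow_power_int: "qpow \<tau> x powi k = qpow \<tau> (of_int k * x)"
  by (simp add: qpow_def power_int_exp mult_ac)

lemma nome_eq_qpow: "nome \<tau> = qpow \<tau> 1"
  by (simp add: nome_def qpow_def)

lemma norm_qpow: "norm (qpow \<tau> x) = exp (- (2 * pi * Im \<tau> * x))"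
  by (simp add: qpow_def)

text \<open>With n = j - 1/2 the exponent n^2 / 2 is 1/8 + j(j - 1)/2, and the shift of the argument
  by 1/2 produces (-1)^j and -\<i>. In a quotient of two values at the same z only a power of q
  survives from the prefactors.\<close>

lemma vartheta_eq_theta:
  "vartheta z \<tau> = - \<i> * qpow \<tau> (1/8) * exp (- (complex_of_real pi * \<i> * z)) * theta (qpow \<tau> (1/2)) (exp (2 * complex_of_real pi * \<i> * z))"
proof -
  have "vartheta z \<tau> = (\<Sum>\<^sub>\<infinity>j::int. - \<i> * qpow \<tau> (1/8) * exp (- (complex_of_real pi * \<i> * z)) *
     ((-1) powi j * qpow \<tau> (1/2) powi (j * (j - 1)) * exp (2 * complex_of_real pi * \<i> * z) powi j))"
    unfolding vartheta_def Let_def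
  proof (rule infsum_reindex_bij_witness[of _ "\<lambda>j. j - 1" "\<lambda>k. k + 1"])
    fix k :: int
    define j where "j = k + 1"
    have k: "real_of_int k + 1 / 2 = real_of_int j - 1/2" by (simp add: j_def)
    have 1: "qpow \<tau> ((real_of_int j - 1/2)\<^sup>2 / 2) = qpow \<tau> (1/8) * qpow \<tau> (1/2) powi (j * (j - 1))"
      by (simp add: qpow_power_int power2_eq_square field_simps flip: qpow_add)
    have "2 * complex_of_real pi * \<i> * complex_of_real (real_of_int j - 1/2) * (z + 1/2) =
       of_int j * (complex_of_real pi * \<i>) + (of_int j * (2 * complex_of_real pi * \<i> * z) + (- (complex_of_real pi * \<i> * z) + - (complex_of_real pi / 2 * \<i>)))"
      by (simp add: field_simps)
    then have 2: "exp (2 * complex_of_real pi * \<i> * complex_of_real (real_of_int j - 1/2) * (z + 1/2)) =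
       exp (complex_of_real pi * \<i>) powi j * (exp (2 * complex_of_real pi * \<i> * z) powi j * (exp (- (complex_of_real pi * \<i> * z)) * exp (- (complex_of_real pi / 2 * \<i>))))"
      by (simp only: exp_add power_int_exp)
    have 3: "exp (- (complex_of_real pi / 2 * \<i>)) = - \<i>"
      by (simp add: complex_eq_iff Re_exp Im_exp)
    show "- \<i> * qpow \<tau> (1/8) * exp (- (complex_of_real pi * \<i> * z)) *
     ((-1) powi (k + 1) * qpow \<tau> (1/2) powi ((k + 1) * ((k + 1) - 1)) * exp (2 * complex_of_real pi * \<i> * z) powi (k + 1)) =
      qpow \<tau> ((real_of_int k + 1 / 2)\<^sup>2 / 2) * exp (2 * complex_of_real pi * \<i> * complex_of_real (real_of_int k + 1 / 2) * (z + 1 / 2))"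
      unfolding k 1 2 3 j_def[symmetric] by simp
  qed auto
  then show ?thesis unfolding theta_def infsum_cmult_right' .
qed

lemma eta_eq_euler: "eta \<tau> = qpow \<tau> (1/24) * euler (nome \<tau>)"
  by (simp add: eta_def euler_def)

text \<open>\<open>theta_half_nome\<close> trades the numerator for a denominator at the shifted
  argument, so that f becomes a product of three reciprocals. For x = a this is also what removes
  the factor theta(a) carried by B.\<close>

lemma theta_quotient:
  assumes "s \<noteq> 0" "norm s ^ 2 < norm x" "norm x < 1"
  shows "theta (s\<^sup>2) x / theta s x = euler (s^4) ^ 2 / (euler (s\<^sup>2) * theta (s\<^sup>2) (s\<^sup>2 * x))"
proof -
  have s: "norm s < 1" using assms power_less_one_iff[of "norm s" 2] by force
  have x: "x \<noteq> 0" using assms by auto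
  have n4: "norm (s ^ 4) < 1" using s by (simp add: norm_power power_less_one_iff)
  have eq: "theta s x * euler (s^4) ^ 2 = euler (s\<^sup>2) * theta (s\<^sup>2) x * theta (s\<^sup>2) (s\<^sup>2 * x)"
    by (rule theta_half_nome[OF assms(1) s x])
  have "theta s x * euler (s^4) ^ 2 \<noteq> 0"
    using theta_nonzero[OF assms] euler_nonzero[OF n4] by simp
  then have nz: "euler (s\<^sup>2) \<noteq> 0" "theta (s\<^sup>2) (s\<^sup>2 * x) \<noteq> 0" unfolding eq by auto
  then show ?thesis
    using eq theta_nonzero[OF assms] by (simp add: field_simps)
qed

lemma ffun_has_sum:
  assumes \<tau>: "Im \<tau> > 0" and reg: "region \<tau> z1 z2"
  defines "s \<equiv> qpow \<tau> (1/2)"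
  shows "((\<lambda>m. qpow \<tau> (1/2) / (eta \<tau> ^ 5 / eta (2 * \<tau>)) * quotient_coeff s (fst m) (snd m) *
      exp (2 * complex_of_real pi * \<i> * z1) powi fst m * exp (2 * complex_of_real pi * \<i> * z2) powi snd m)
      has_sum ffun z1 z2 \<tau>) UNIV"
proof -
  define a b where "a = exp (2 * complex_of_real pi * \<i> * z1)" and "b = exp (2 * complex_of_real pi * \<i> * z2)"
  define q where "q = nome \<tau>"
  have q: "q = s\<^sup>2" "q\<^sup>2 = s ^ 4" by (simp_all add: q_def s_def nome_eq_qpow qpow_power)
  have s: "s \<noteq> 0" "norm s < 1" using \<tau> by (simp_all add: s_def norm_qpow)
  have reg': "norm s ^ 2 < norm a" "norm a < 1" "norm s ^ 2 < norm b" "norm b < 1"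
    "norm s ^ 2 < norm (a * b)" "norm (a * b) < 1"
    using reg by (simp_all add: region_def Let_def a_def[symmetric] b_def[symmetric] q_def[symmetric] q(1) norm_power)
  have nq: "norm q < 1" "norm (q\<^sup>2) < 1"
    using s by (simp_all add: q norm_power power_less_one_iff)
  have e: "euler q \<noteq> 0" "euler (q\<^sup>2) \<noteq> 0" using euler_nonzero nq by auto
  have ab: "exp (2 * complex_of_real pi * \<i> * (z1 + z2)) = a * b"
    by (simp add: a_def b_def distrib_left exp_add)
  have ratio: "vartheta z (2 * \<tau>) / vartheta z \<tau> = qpow \<tau> (1/8) * (theta q (exp (2 * complex_of_real pi * \<i> * z)) / theta s (exp (2 * complex_of_real pi * \<i> * z)))" for z
  proof -
    have "qpow \<tau> (1/4) = qpow \<tau> (1/8) * qpow \<tau> (1/8)" by (simp flip: qpow_add)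
    then show ?thesis
      by (simp add: vartheta_eq_theta qpow_double s_def q_def nome_eq_qpow)
  qed
  define TA TB TC where "TA = theta q (q * a)" and "TB = theta q (q * b)" and "TC = theta q (q * (a * b))"
  have quot: "theta q x / theta s x = euler (q\<^sup>2) ^ 2 / (euler q * theta q (q * x))"
    if "norm s ^ 2 < norm x" "norm x < 1" for x
    using theta_quotient[OF s(1) that] by (simp add: q)
  have ff: "ffun z1 z2 \<tau> = qpow \<tau> (3/8) * (theta q a / theta s a) * (theta q b / theta s b) * (theta q (a * b) / theta s (a * b))"
  proof -
    have "ffun z1 z2 \<tau> = (vartheta z1 (2 * \<tau>) / vartheta z1 \<tau>) * (vartheta z2 (2 * \<tau>) / vartheta z2 \<tau>) * (vartheta (z1 + z2) (2 * \<tau>) / vartheta (z1 + z2) \<tau>)"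
      by (simp add: ffun_def)
    also have "\<dots> = (qpow \<tau> (1/8) * qpow \<tau> (1/8) * qpow \<tau> (1/8)) * (theta q a / theta s a) * (theta q b / theta s b) * (theta q (a * b) / theta s (a * b))"
      unfolding ratio ab a_def[symmetric] b_def[symmetric] by (simp add: mult_ac)
    also have "qpow \<tau> (1/8) * qpow \<tau> (1/8) * qpow \<tau> (1/8) = qpow \<tau> (3/8)"
      by (simp flip: qpow_add)
    finally show ?thesis .
  qed
  define E where "E = eta \<tau> ^ 5 / eta (2 * \<tau>)"
  have E: "E = qpow \<tau> (1/8) * (euler q ^ 5 / euler (q\<^sup>2))"
  proof -
    \<comment> \<open>The exponent is 5/24 from the fifth power of eta, less 2/24 from eta at
      2\<tau>.\<close>
    have "qpow \<tau> (1/8) = qpow \<tau> (5/24) / qpow \<tau> (1/12)" by (simp flip: qpow_diff)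
    moreover have "nome (2 * \<tau>) = q\<^sup>2" by (simp add: q_def nome_eq_qpow qpow_double qpow_power)
    ultimately show ?thesis
      by (simp add: E_def eta_eq_euler power_mult_distrib qpow_power qpow_double q_def)
  qed
  define H where "H = euler q ^ 3 * euler (q\<^sup>2) ^ 3 * theta q a / (theta s a * TB * TC)"
  have H: "((\<lambda>(M1,M2). quotient_coeff s M1 M2 * a powi M1 * b powi M2) has_sum H) UNIV"
    unfolding H_def TB_def TC_def q(2) unfolding q(1) by (rule quotient_coeff_has_sum[OF s reg'(1-5)])
  have nz: "TA \<noteq> 0" "TB \<noteq> 0" "TC \<noteq> 0" "theta s a \<noteq> 0"
  proof -
    have "theta q (q * x) \<noteq> 0" if "norm s ^ 2 < norm x" "norm x < 1" for x
      using that s by (intro theta_times_nome_nonzero) (auto simp: q norm_power)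
    then show "TA \<noteq> 0" "TB \<noteq> 0" "TC \<noteq> 0" using reg' by (auto simp: TA_def TB_def TC_def)
    show "theta s a \<noteq> 0" by (rule theta_nonzero[OF s(1) reg'(1,2)])
  qed
  have "qpow \<tau> (1/2) / E * H = ffun z1 z2 \<tau>"
  proof -
    \<comment> \<open>The 1/8 belongs to the eta quotient and the 3/8 to the three theta quotients;
      together they match the constant term 1/2 of the exponent 2 Q(n1 - 1/2, n2 - 1/2) in
      F.\<close>
    have qp: "qpow \<tau> (1/2) = qpow \<tau> (1/8) * qpow \<tau> (3/8)" by (simp flip: qpow_add)
    have "H = euler q ^ 3 * euler (q\<^sup>2) ^ 3 * (theta q a / theta s a) / (TB * TC)" by (simp add: H_def)
    also have "\<dots> = euler q ^ 3 * euler (q\<^sup>2) ^ 3 * (euler (q\<^sup>2) ^ 2 / (euler q * TA)) / (TB * TC)"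
      unfolding quot[OF reg'(1,2)] TA_def ..
    finally have H': "H = euler q ^ 3 * euler (q\<^sup>2) ^ 3 * (euler (q\<^sup>2) ^ 2 / (euler q * TA)) / (TB * TC)" .
    have "qpow \<tau> (1/2) / E * H = qpow \<tau> (3/8) * (euler (q\<^sup>2) ^ 2 / (euler q * TA)) * (euler (q\<^sup>2) ^ 2 / (euler q * TB)) * (euler (q\<^sup>2) ^ 2 / (euler q * TC))"
      unfolding E H' qp using e nz by (simp add: field_simps eval_nat_numeral)
    also have "\<dots> = ffun z1 z2 \<tau>"
      unfolding ff quot[OF reg'(1,2)] quot[OF reg'(3,4)] quot[OF reg'(5,6)] TA_def TB_def TC_def ..
    finally show ?thesis .
  qed
  with has_sum_cmult_right[OF H, of "qpow \<tau> (1/2) / E"] show ?thesis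
    unfolding E_def a_def b_def by (simp add: case_prod_unfold mult.assoc)
qed

lemma region_laurent_coeff_ffun:
  assumes \<tau>: "Im \<tau> > 0"
  shows "region_laurent_coeff (\<lambda>z1 z2. ffun z1 z2 \<tau>) \<tau> =
    (\<lambda>m. qpow \<tau> (1/2) / (eta \<tau> ^ 5 / eta (2 * \<tau>)) * quotient_coeff (qpow \<tau> (1/2)) (fst m) (snd m))"
  unfolding region_laurent_coeff_def
proof (rule the_equality, goal_cases)
  case 1
  then show ?case using ffun_has_sum[OF \<tau>] by blast
next
  case (2 c)
  define c' where "c' = (\<lambda>m. qpow \<tau> (1/2) / (eta \<tau> ^ 5 / eta (2 * \<tau>)) * quotient_coeff (qpow \<tau> (1/2)) (fst m) (snd m))"
  have "c m - c' m = 0" for m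
  proof (rule laurent_coeff_unique2[where \<rho> = "norm (qpow \<tau> (1/4))" and c = "\<lambda>m. c m - c' m"])
    \<comment> \<open>At radius \<bar>q\<bar>^(1/4) the variables and their product, of norm
      \<bar>q\<bar>^(1/2), all lie strictly between \<bar>q\<bar> and 1; logarithms then supply
      \<open>z1\<close> and \<open>z2\<close>.\<close>
    fix a b :: complex
    assume ab: "norm a = norm (qpow \<tau> (1/4))" "norm b = norm (qpow \<tau> (1/4))"
    then have nz: "a \<noteq> 0" "b \<noteq> 0" by auto
    define z1 z2 where "z1 = Ln a / (2 * complex_of_real pi * \<i>)" and "z2 = Ln b / (2 * complex_of_real pi * \<i>)"
    have z: "exp (2 * complex_of_real pi * \<i> * z1) = a" "exp (2 * complex_of_real pi * \<i> * z2) = b"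
      using nz by (simp_all add: z1_def z2_def)
    have "norm (a * b) = exp (- (2 * pi * Im \<tau> * (1/2)))"
      unfolding norm_mult ab norm_qpow by (simp flip: exp_add)
    then have reg: "region \<tau> z1 z2"
      using \<tau> unfolding region_def Let_def z by (simp add: ab norm_qpow nome_eq_qpow)
    have "((\<lambda>m. c m * a powi fst m * b powi snd m - c' m * a powi fst m * b powi snd m) has_sum (ffun z1 z2 \<tau> - ffun z1 z2 \<tau>)) UNIV"
      using 2[rule_format, OF reg] ffun_has_sum[OF \<tau> reg] unfolding z c'_def by (rule has_sum_diff)
    then show "((\<lambda>m. (c m - c' m) * a powi fst m * b powi snd m) has_sum 0) UNIV"
      by (simp add: left_diff_distrib)
  qed simp
  then show ?case by (auto simp: c'_def fun_eq_iff)
qed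

theorem theorem3p1:
  fixes \<tau> :: complex and r1 r2 :: int
  assumes "Im \<tau> > 0"
  shows "(F_coeff_term 2 \<tau> (r1, r2) has_sum
           (qpow \<tau> (2 * Qf (real_of_int r1) (real_of_int r2)) * eta \<tau> ^ 5 / eta (2 * \<tau>)
            * region_laurent_coeff (\<lambda>z1 z2. ffun z1 z2 \<tau>) \<tau> (2 * r1 - r2, r1 + r2))) UNIV"
proof -
  define s where "s = qpow \<tau> (1/2)"
  have s: "s \<noteq> 0" "norm s < 1" using assms by (simp_all add: s_def norm_qpow)
  have qpowi: "qpow \<tau> (of_int k) = (s\<^sup>2) powi k" for k
    by (simp add: s_def qpow_power qpow_power_int)
  have qf: "2 * Qf (real_of_int x) (real_of_int y) = of_int (qform x y)" for x y
    by (simp add: Qf_def qform_def power2_eq_square)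
  have nz: "eta \<tau> ^ 5 / eta (2 * \<tau>) \<noteq> 0"
  proof -
    have "norm (nome \<tau>) < 1" "norm (nome (2 * \<tau>)) < 1"
      using assms by (simp_all add: nome_eq_qpow norm_qpow)
    then show ?thesis by (simp add: eta_eq_euler euler_nonzero)
  qed
  have "((\<lambda>(n1,n2). qpow \<tau> (1/2) * ((s\<^sup>2) powi (qform n1 n2 - n1 - n2) * of_int (weyl_coeff n1 n2 (r1, r2)))) has_sum
    (qpow \<tau> (1/2) * ((s\<^sup>2) powi qform r1 r2 * quotient_coeff s (2 * r1 - r2) (r1 + r2)))) UNIV"
    using has_sum_cmult_right[OF has_sum_weyl_coeff_eq_quotient_coeff[OF s]] by (simp add: case_prod_unfold)
  also have "(\<lambda>(n1,n2). qpow \<tau> (1/2) * ((s\<^sup>2) powi (qform n1 n2 - n1 - n2) * of_int (weyl_coeff n1 n2 (r1, r2)))) = F_coeff_term 2 \<tau> (r1, r2)"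
  proof (intro ext, clarify)
    fix n1 n2 :: int
    have "real 2 * Qf (real_of_int n1 - 1 / real 2) (real_of_int n2 - 1 / real 2) = 1/2 + of_int (qform n1 n2 - n1 - n2)"
      by (simp add: Qf_def qform_def power2_eq_square field_simps)
    then show "qpow \<tau> (1/2) * ((s\<^sup>2) powi (qform n1 n2 - n1 - n2) * of_int (weyl_coeff n1 n2 (r1, r2))) = F_coeff_term 2 \<tau> (r1, r2) (n1, n2)"
      unfolding F_coeff_term_def fst_conv snd_conv lpoly_coeff_Fsummand by (simp only: qpow_add qpowi mult.assoc)
  qed
  also have "qpow \<tau> (1/2) * ((s\<^sup>2) powi qform r1 r2 * quotient_coeff s (2 * r1 - r2) (r1 + r2)) =
     qpow \<tau> (2 * Qf (real_of_int r1) (real_of_int r2)) * eta \<tau> ^ 5 / eta (2 * \<tau>)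
            * region_laurent_coeff (\<lambda>z1 z2. ffun z1 z2 \<tau>) \<tau> (2 * r1 - r2, r1 + r2)"
    unfolding region_laurent_coeff_ffun[OF assms] qf qpowi fst_conv snd_conv s_def[symmetric]
    using nz by (simp add: field_simps)
  finally show ?thesis .
qed

end
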